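(* Let $\ell,d\geq 1$, $p>2$, $T>0$, let $\mathbf{X}$ be a Hölder branched $p$-rough path over $\mathbb{R}^\ell$ on $[0,T]$, and let $V_1,\dots,V_\ell$ be vector fields on $\mathbb{R}^d$ of class $C^\gamma$ for some $\gamma>p$. An $\mathbb{R}^d$-valued path $(z_t)_{0\leq t\leq T}$ is a solution to the rough differential equation $dz_t=\mathrm{F}(z_t)\,d\mathbf{X}_t$, $\mathrm{F}=(V_1,\dots,V_\ell)$, driven by the branched rough path $\mathbf{X}$ in the sense of Davie if and only if it is a solution of that equation in the sense of Bailleul.
   Context: Trees: $\mathcal{T}$ is the set of rooted trees with vertices labelled in $\{1,\dots,\ell\}$, including the empty tree $\mathbf{1}$; for trees $\tau_1,\dots,\tau_k$ and a label $a$, $[\tau_1\cdots\tau_k]_a$ is the tree obtained by grafting $\tau_1,\dots,\tau_k$ onto a new root labelled $a$ ($\bullet_a=[\,]_a$). $|\tau|$ is the number of vertices. Symmetry factor: $\sigma([\tau_1^{n_1}\cdots\tau_k^{n_k}]_a)=n_1!\cdots n_k!\,\sigma(\tau_1)^{n_1}\cdots\sigma(\tau_k)^{n_k}$ for distinct $\tau_i$ with multiplicities $n_i$ (so $\sigma(\bullet_a)=1$); for a forest $\tau_1\cdots\tau_n$, $\sigma(\tau_1\cdots\tau_n):=\sigma([\tau_1\cdots\tau_n]_a)$ (independent of $a$). $\mathcal{F}$ is the commutative polynomial algebra generated by the nonempty trees (unit $\mathbf{1}$); its monomials $\varphi=\tau_1\cdots\tau_n$ are forests, $|\varphi|=\sum|\tau_i|$,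 and they form a basis $\mathcal{B}$ with dual basis $(\theta^* )$ of the dual $\mathcal{F}^*$. Coproduct: for a tree $\tau$, $\Delta\tau=\sum_{s}(\tau\setminus s)\otimes s$, the sum over subtrees $s$ of $\tau$ containing the root of $\tau$ (including the empty tree and $\tau$), where $\tau\setminus s$ is the forest of trees obtained by removing $s$ and its adjacent edges; $\Delta$ is extended multiplicatively and linearly. For $\mathbf{Y},\mathbf{Z}\in\mathcal{F}^*$, $\langle\mathbf{Y}\star\mathbf{Z},\theta\rangle=(\mathbf{Y}\otimes\mathbf{Z})(\Delta\theta)$. $\exp_\star(\mathbf{a})=\sum_{n\geq0}\mathbf{a}^{\star n}/n!$ ($\mathbf{a}^{\star0}=\mathbf{1}^*$), $\log_\star(\mathbf{b})=\sum_{n\geq1}(\mathbf{1}^*-\mathbf{b})^{\star n}/n$ (with the sign convention of the paper, i.e. the inverse of $\exp_\star$ on elements with $\langle\mathbf{b},\mathbf{1}\rangle=1$). For an integer $N$, $\pi_{\leq N}$ is the projection of $\mathcal{F}^*$ killing the dual forests $\theta^*$ with $|\theta|>N$, and $\mathcal{G}^N_\ell=\pi_{\leq N}\exp_\star(\langle\mathcal{T}^*\rangle)$, a group under $\pi_{\leq N}\circ\star$ (still denoted $\star$), where $\langle\mathcal{T}^*\rangle$ is the span of the dual trees. A Hölder branched $p$-rough path on $[0,T]$ is a path $\mathbf{X}:[0,T]\to\mathcal{G}^{[p]}_\ell$ such that, with $\mathbf{X}_{ts}:=\mathbf{X}_s^{-1}\star\mathbf{X}_t$ and $X^\varphi_{ts}:=\langle\mathbf{X}_{ts},\varphi\rangle$,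 $\sup_{s<t}|X^\varphi_{ts}|/|t-s|^{|\varphi|/p}<\infty$ for every forest $\varphi$ with $|\varphi|\leq[p]$. Differential operators: $V(\bullet_a^* )=V_a$ and recursively $V(([\tau_1\cdots\tau_n]_a)^* )=\frac{1}{\sigma([\tau_1\cdots\tau_n]_a)}(D^nV_a)(V(\tau_1^* ),\dots,V(\tau_n^* ))$ (vector fields), and for a nonempty forest, $V(\tau_1^*\cdots\tau_n^* )f=\frac{1}{\sigma(\tau_1\cdots\tau_n)}(D^nf)(V(\tau_1^* ),\dots,V(\tau_n^* ))$. A path $z$ is a solution in the sense of Davie if for some $a>1$ and all $0\leq s\leq t\leq T$, $z_t=z_s+\sum_{\varphi\in\mathcal{B},\,1\leq|\varphi|\leq[p]}X^\varphi_{ts}\,(V(\varphi^* )\mathrm{Id})(z_s)+O(|t-s|^a)$. It is a solution in the sense of Bailleul if for some $a>1$, every real-valued $C^\gamma$ function $f$ on $\mathbb{R}^d$ and all $0\leq s\leq t\leq T$, $f(z_t)=f(z_s)+\sum_{\varphi\in\mathcal{B},\,1\leq|\varphi|\leq[p]}X^\varphi_{ts}\,(V(\varphi^* )f)(z_s)+O_f(|t-s|^a)$, where $O_f$ may depend on $f$. *)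

theory Defs
  imports "HOL-Analysis.Analysis" "HOL-Library.Multiset"
begin

text \<open>A nonempty rooted tree with a labelled root and an (unordered) multiset of
  subtrees; Node a {#t1,...,tk#} is the grafting [t1 ... tk]_a.  A forest is a
  multiset of nonempty trees; the empty forest is the empty tree / unit 1.\<close>

datatype tree = Node nat "tree multiset"

type_synonym forest = "tree multiset"

primrec tsize :: "tree \<Rightarrow> nat" where
  "tsize (Node a ch) = 1 + sum_mset (image_mset tsize ch)"

definition fsize :: "forest \<Rightarrow> nat" where
  "fsize \<phi> = sum_mset (image_mset tsize \<phi>)"

primrec tree_ok :: "nat \<Rightarrow> tree \<Rightarrow> bool" where
  "tree_ok l (Node a ch) = (1 \<le> a \<and> a \<le> l \<and> (\<forall>b\<in>#image_mset (tree_ok l) ch. b))"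

definition forest_ok :: "nat \<Rightarrow> forest \<Rightarrow> bool" where
  "forest_ok l \<phi> = (\<forall>\<tau>\<in>#\<phi>. tree_ok l \<tau>)"

primrec tsigma :: "tree \<Rightarrow> nat" where
  "tsigma (Node a ch) =
     (\<Prod>\<tau>\<in>set_mset ch. fact (count ch \<tau>)) * prod_mset (image_mset tsigma ch)"

definition fsigma :: "forest \<Rightarrow> nat" where
  "fsigma \<phi> = tsigma (Node 1 \<phi>)"

text \<open>The coproduct of a forest is encoded as a multiset of pairs (left, right)
  of forests, i.e. Delta theta = sum over pairs of left \<otimes> right, multiplicities
  being coefficients.\<close>

definition cut_mult ::
  "(forest \<times> forest) multiset \<Rightarrow> (forest \<times> forest) multiset \<Rightarrow> (forest \<times> forest) multiset" where
  "cut_mult A B = (\<Sum>x\<in>#A. image_mset (\<lambda>y. (fst x + fst y, snd x + snd y)) B)"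

definition cut_prod :: "(forest \<times> forest) multiset multiset \<Rightarrow> (forest \<times> forest) multiset" where
  "cut_prod M = fold_mset cut_mult {#({#}, {#})#} M"

text \<open>Delta tau = sum over root-containing subtrees s (including empty and tau)
  of (tau minus s) \<otimes> s.\<close>
primrec tree_cuts :: "tree \<Rightarrow> (forest \<times> forest) multiset" where
  "tree_cuts (Node a ch) =
     add_mset ({#Node a ch#}, {#})
       (image_mset (\<lambda>c. (fst c, {#Node a (snd c)#})) (cut_prod (image_mset tree_cuts ch)))"

definition forest_cuts :: "forest \<Rightarrow> (forest \<times> forest) multiset" where
  "forest_cuts \<phi> = cut_prod (image_mset tree_cuts \<phi>)"

text \<open>Elements of the dual F* are given by their values on the basis of forests.\<close>
type_synonym dual = "forest \<Rightarrow> real"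

definition conv :: "dual \<Rightarrow> dual \<Rightarrow> dual" where
  "conv Y Z \<theta> = (\<Sum>c\<in>#forest_cuts \<theta>. Y (fst c) * Z (snd c))"

definition unit_dual :: dual where
  "unit_dual \<theta> = (if \<theta> = {#} then 1 else 0)"

primrec conv_pow :: "dual \<Rightarrow> nat \<Rightarrow> dual" where
  "conv_pow a 0 = unit_dual"
| "conv_pow a (Suc n) = conv a (conv_pow a n)"

definition exp_star :: "dual \<Rightarrow> dual" where
  "exp_star a \<theta> = (\<Sum>n. conv_pow a n \<theta> / fact n)"

definition trunc :: "nat \<Rightarrow> dual \<Rightarrow> dual" where
  "trunc N Y \<theta> = (if fsize \<theta> \<le> N then Y \<theta> else 0)"

definition tree_span :: "nat \<Rightarrow> dual \<Rightarrow> bool" where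
  "tree_span l a \<longleftrightarrow> finite {\<theta>. a \<theta> \<noteq> 0} \<and>
     (\<forall>\<theta>. a \<theta> \<noteq> 0 \<longrightarrow> (\<exists>\<tau>. \<theta> = {#\<tau>#} \<and> tree_ok l \<tau>))"

definition Ggrp :: "nat \<Rightarrow> nat \<Rightarrow> dual set" where
  "Ggrp N l = {trunc N (exp_star a) | a. tree_span l a}"

definition tprod :: "nat \<Rightarrow> dual \<Rightarrow> dual \<Rightarrow> dual" where
  "tprod N Y Z = trunc N (conv Y Z)"

definition ginv :: "nat \<Rightarrow> nat \<Rightarrow> dual \<Rightarrow> dual" where
  "ginv N l X = (THE Y. Y \<in> Ggrp N l \<and> tprod N Y X = unit_dual)"

definition incr :: "nat \<Rightarrow> nat \<Rightarrow> (real \<Rightarrow> dual) \<Rightarrow> real \<Rightarrow> real \<Rightarrow> dual" where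
  "incr N l X s t = tprod N (ginv N l (X s)) (X t)"

definition branched_rough_path :: "nat \<Rightarrow> real \<Rightarrow> real \<Rightarrow> (real \<Rightarrow> dual) \<Rightarrow> bool" where
  "branched_rough_path l p T X \<longleftrightarrow>
     (\<forall>t\<in>{0..T}. X t \<in> Ggrp (nat \<lfloor>p\<rfloor>) l) \<and>
     (\<forall>\<phi>. forest_ok l \<phi> \<and> fsize \<phi> \<le> nat \<lfloor>p\<rfloor> \<longrightarrow>
        (\<exists>C. \<forall>s t. 0 \<le> s \<and> s < t \<and> t \<le> T \<longrightarrow>
           \<bar>incr (nat \<lfloor>p\<rfloor>) l X s t \<phi>\<bar> \<le> C * (t - s) powr (real (fsize \<phi>) / p)))"

fun nderiv :: "('a::real_normed_vector \<Rightarrow> 'b::real_normed_vector) \<Rightarrow> 'a \<Rightarrow> 'a list \<Rightarrow> 'b" where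
  "nderiv f x [] = f x"
| "nderiv f x (h # hs) = frechet_derivative (\<lambda>y. nderiv f y hs) (at x) h"

text \<open>C^gamma (Hoelder--Zygmund style, local version): with k the largest integer
  strictly smaller than gamma, f is k times continuously differentiable and its
  k-th derivative is (gamma - k)-Hoelder on bounded sets.\<close>
definition C_gamma :: "real \<Rightarrow> ('a::euclidean_space \<Rightarrow> 'b::real_normed_vector) \<Rightarrow> bool" where
  "C_gamma \<gamma> f \<longleftrightarrow> (let k = nat (\<lceil>\<gamma>\<rceil> - 1) in
     (\<forall>hs. length hs < k \<longrightarrow> (\<forall>x. (\<lambda>y. nderiv f y hs) differentiable (at x))) \<and>
     (\<forall>hs. length hs \<le> k \<longrightarrow> continuous_on UNIV (\<lambda>y. nderiv f y hs)) \<and>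
     (\<forall>B. bounded B \<longrightarrow> (\<exists>C. \<forall>x\<in>B. \<forall>y\<in>B. \<forall>hs. length hs = k \<longrightarrow>
        norm (nderiv f x hs - nderiv f y hs) \<le> C * dist x y powr (\<gamma> - real k) * prod_list (map norm hs))))"

definition list_of_mset :: "'a multiset \<Rightarrow> 'a list" where
  "list_of_mset M = (SOME xs. mset xs = M)"

primrec vfield :: "(nat \<Rightarrow> 'a::real_normed_vector \<Rightarrow> 'a) \<Rightarrow> tree \<Rightarrow> 'a \<Rightarrow> 'a" where
  "vfield V (Node a ch) = (\<lambda>x. (1 / real (tsigma (Node a ch))) *\<^sub>R
      nderiv (V a) x (map (\<lambda>g. g x) (list_of_mset (image_mset (vfield V) ch))))"

definition diffop :: "(nat \<Rightarrow> 'a::real_normed_vector \<Rightarrow> 'a) \<Rightarrow> forest \<Rightarrow> ('a \<Rightarrow> 'b::real_normed_vector) \<Rightarrow> 'a \<Rightarrow> 'b" where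
  "diffop V \<phi> f x = (1 / real (fsigma \<phi>)) *\<^sub>R nderiv f x (map (\<lambda>\<tau>. vfield V \<tau> x) (list_of_mset \<phi>))"

definition rde_forests :: "nat \<Rightarrow> nat \<Rightarrow> forest set" where
  "rde_forests l N = {\<phi>. forest_ok l \<phi> \<and> 1 \<le> fsize \<phi> \<and> fsize \<phi> \<le> N}"

definition davie_solution ::
  "nat \<Rightarrow> real \<Rightarrow> real \<Rightarrow> (real \<Rightarrow> dual) \<Rightarrow> (nat \<Rightarrow> 'a::euclidean_space \<Rightarrow> 'a) \<Rightarrow> (real \<Rightarrow> 'a) \<Rightarrow> bool" where
  "davie_solution l p T X V z \<longleftrightarrow>
     (\<exists>a>1. \<exists>C. \<forall>s t. 0 \<le> s \<and> s \<le> t \<and> t \<le> T \<longrightarrow>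
        norm (z t - z s - (\<Sum>\<phi>\<in>rde_forests l (nat \<lfloor>p\<rfloor>).
               incr (nat \<lfloor>p\<rfloor>) l X s t \<phi> *\<^sub>R diffop V \<phi> id (z s))) \<le> C * (t - s) powr a)"

definition bailleul_solution ::
  "nat \<Rightarrow> real \<Rightarrow> real \<Rightarrow> real \<Rightarrow> (real \<Rightarrow> dual) \<Rightarrow> (nat \<Rightarrow> 'a::euclidean_space \<Rightarrow> 'a) \<Rightarrow> (real \<Rightarrow> 'a) \<Rightarrow> bool" where
  "bailleul_solution l p T \<gamma> X V z \<longleftrightarrow>
     (\<exists>a>1. \<forall>f :: 'a \<Rightarrow> real. C_gamma \<gamma> f \<longrightarrow>
        (\<exists>C. \<forall>s t. 0 \<le> s \<and> s \<le> t \<and> t \<le> T \<longrightarrow>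
          \<bar>f (z t) - f (z s) - (\<Sum>\<phi>\<in>rde_forests l (nat \<lfloor>p\<rfloor>).
               incr (nat \<lfloor>p\<rfloor>) l X s t \<phi> * diffop V \<phi> f (z s))\<bar> \<le> C * (t - s) powr a))"

end

theory Submission
  imports Defs "HOL-Combinatorics.Multiset_Permutations"
begin

text \<open>Testing Bailleul's expansion against the coordinate functions gives Davie's, because iterated
  derivatives of order at least two of a linear function vanish.

  Conversely, let \<open>H = \<Sum>\<^sub>\<tau> X\<^sup>\<tau> V(\<tau>\<^sup>*)Id(z\<^sub>s)\<close> be the sum over trees of size at most \<open>N = [p]\<close>. Davie's
  expansion says that \<open>z\<^sub>t - z\<^sub>s - H\<close> is of order \<open>a > 1\<close> and bounds \<open>z\<close>, so \<open>f(z\<^sub>t)\<close> may be replaced by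
  \<open>f(z\<^sub>s + H)\<close>. As \<open>|H|\<close> is of order \<open>1/p\<close>, Taylor's formula at \<open>z\<^sub>s\<close> has a remainder of order
  \<open>min \<gamma> (N + 1) / p > 1\<close>. Its polynomial part is a sum over lists of trees; collecting the lists with
  the same underlying forest (the derivatives are symmetric) produces the inverse symmetry factors,
  hence the terms \<open>(\<Prod>\<^sub>i X\<^sup>\<tau>\<^sup>i) V(\<phi>\<^sup>*)f\<close>. Forests of size more than \<open>N\<close> are of order \<open>(N + 1)/p\<close>, and for the
  others the product is \<open>X\<^sup>\<phi>\<close>, since \<open>exp\<^sub>\<star>\<close> maps the span of the dual trees to characters, which are
  stable under convolution and inversion.\<close>

section \<open>Convolution of functionals on forests\<close>

text \<open>An arbitrary test function \<open>F\<close> turns identities between multisets of cuts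
  into identities between iterated sums; singletons as values recover the multisets
  themselves.\<close>

lemma sum_cut_mult:
  fixes F :: "forest \<times> forest \<Rightarrow> 'a::comm_monoid_add"
  shows "(\<Sum>x\<in>#cut_mult A B. F x) = (\<Sum>x\<in>#A. \<Sum>y\<in>#B. F (x + y))"
proof -
  have *: "(\<lambda>y. (fst x + fst y, snd x + snd y)) = (\<lambda>y. x + y)" for x :: "forest \<times> forest"
    by (auto simp: plus_prod_def)
  show ?thesis unfolding cut_mult_def * 
    by (induction A) (auto simp: image_mset.compositionality o_def)
qed

lemma cut_mult_conv_sum: "cut_mult A B = (\<Sum>x\<in>#A. \<Sum>y\<in>#B. {#x + y#})"
  using sum_cut_mult[of "\<lambda>x. {#x#}" A B] by simp

lemma cut_mult_left_commute: "cut_mult A (cut_mult B C) = cut_mult B (cut_mult A C)"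
proof -
  have "cut_mult A (cut_mult B C) = (\<Sum>x\<in>#A. \<Sum>y\<in>#B. \<Sum>z\<in>#C. {#x + (y + z)#})" for A B C
    unfolding cut_mult_conv_sum[of A "cut_mult B C"] sum_cut_mult ..
  then show ?thesis
    by (simp add: add.left_commute sum_mset.swap[of _ A B])
qed

lemma cut_mult_assoc: "cut_mult (cut_mult A B) C = cut_mult A (cut_mult B C)"
  unfolding cut_mult_conv_sum[of "cut_mult A B" C] cut_mult_conv_sum[of A "cut_mult B C"]
    sum_cut_mult add.assoc ..

lemma cut_mult_unit [simp]: "cut_mult {#({#}, {#})#} B = B" "cut_mult B {#({#}, {#})#} = B"
  by (simp_all add: cut_mult_conv_sum plus_prod_def)

text \<open>\<open>fold_mset\<close> unfolds recursively for a left-commutative operation, which is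
  what \<open>cut_mult_left_commute\<close> provides.\<close>

lemma cut_prod_simps [simp]:
  "cut_prod {#} = {#({#}, {#})#}"
  "cut_prod (add_mset A M) = cut_mult A (cut_prod M)"
proof -
  interpret comp_fun_commute cut_mult
    by standard (auto simp: fun_eq_iff cut_mult_left_commute)
  show "cut_prod {#} = {#({#}, {#})#}"
    by (simp add: cut_prod_def)
  show "cut_prod (add_mset A M) = cut_mult A (cut_prod M)"
    by (simp add: cut_prod_def)
qed

lemma forest_cuts_empty [simp]: "forest_cuts {#} = {#({#}, {#})#}"
  by (simp add: forest_cuts_def)

lemma forest_cuts_union: "forest_cuts (\<phi> + \<psi>) = cut_mult (forest_cuts \<phi>) (forest_cuts \<psi>)"
  by (induction \<phi>) (auto simp: forest_cuts_def cut_mult_assoc)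

text \<open>The cocycle identity of grafting: apart from the cut with empty root subtree, a cut of
  the tree is a cut of its branches with the root grafted back onto the right factor.\<close>

lemma forest_cuts_Node:
  "forest_cuts {#Node a \<phi>#} =
     add_mset ({#Node a \<phi>#}, {#}) (image_mset (\<lambda>c. (fst c, {#Node a (snd c)#})) (forest_cuts \<phi>))"
  by (simp add: forest_cuts_def)

lemma sum_forest_cuts_union:
  fixes F :: "forest \<times> forest \<Rightarrow> 'a::comm_monoid_add"
  shows "(\<Sum>c\<in>#forest_cuts (\<phi> + \<psi>). F c) =
    (\<Sum>c\<in>#forest_cuts \<phi>. \<Sum>d\<in>#forest_cuts \<psi>. F (c + d))"
  by (simp add: forest_cuts_union sum_cut_mult)

lemma sum_forest_cuts_Node:
  fixes F :: "forest \<times> forest \<Rightarrow> 'a::comm_monoid_add"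
  shows "(\<Sum>c\<in>#forest_cuts {#Node a \<phi>#}. F c) =
    F ({#Node a \<phi>#}, {#}) + (\<Sum>c\<in>#forest_cuts \<phi>. F (fst c, {#Node a (snd c)#}))"
  by (simp add: forest_cuts_Node image_mset.compositionality o_def)

text \<open>Forests are generated from the empty one by grafting and product, the two operations
  whose effect on Delta is known. Induction on the tree datatype handles the branches, closure under
  union passes from trees to forests.\<close>

lemma forest_induct [case_names empty graft union]:
  assumes "P {#}" and graft: "\<And>a \<phi>. P \<phi> \<Longrightarrow> P {#Node a \<phi>#}"
    and union: "\<And>\<phi> \<psi>. P \<phi> \<Longrightarrow> P \<psi> \<Longrightarrow> P (\<phi> + \<psi>)"
  shows "P \<phi>"
proof -
  have step: "P \<phi>" if "\<And>t. t \<in># \<phi> \<Longrightarrow> P {#t#}" for \<phi>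
    using that
  proof (induction \<phi>)
    case (add t \<phi>)
    then show ?case using union[of "{#t#}" \<phi>] by simp
  qed (simp add: assms)
  have "P {#t#}" for t
    by (induction t) (auto intro: graft step)
  then show ?thesis by (rule step)
qed

section \<open>The grading by number of vertices\<close>

lemma fsize_simps [simp]:
  "fsize {#} = 0" "fsize {#t#} = tsize t" "fsize (\<phi> + \<psi>) = fsize \<phi> + fsize \<psi>"
  "fsize (add_mset t \<phi>) = tsize t + fsize \<phi>"
  by (simp_all add: fsize_def)

lemma tsize_Node: "tsize (Node a \<phi>) = Suc (fsize \<phi>)"
  by (simp add: fsize_def)

lemma tsize_pos [simp]: "0 < tsize t"
  by (cases t) simp

lemma fsize_eq_0_iff [simp]: "fsize \<phi> = 0 \<longleftrightarrow> \<phi> = {#}"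
by (cases \<phi>) simp_all

lemma set_mset_cut_mult: "c \<in># cut_mult A B \<Longrightarrow> \<exists>x\<in>#A. \<exists>y\<in>#B. c = x + y"
  by (auto simp: cut_mult_conv_sum)

text \<open>Delta is graded: a grafted root lies in exactly one of the two factors, and sizes add
  under products. Truncation and the inductions on degree rest on this.\<close>

lemma fsize_forest_cuts: "c \<in># forest_cuts \<phi> \<Longrightarrow> fsize (fst c) + fsize (snd c) = fsize \<phi>"
proof (induction \<phi> arbitrary: c rule: forest_induct)
  case (graft a \<phi>)
  then show ?case by (force simp: forest_cuts_Node tsize_Node simp del: tsize.simps)
next
  case (union \<phi> \<psi>)
  from union.prems obtain x y where "x \<in># forest_cuts \<phi>" "y \<in># forest_cuts \<psi>" "c = x + y"
    unfolding forest_cuts_union by (blast dest: set_mset_cut_mult)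
  with union.IH(1)[of x] union.IH(2)[of y] show ?case by simp
qed simp

section \<open>Counit laws and coassociativity\<close>

text \<open>\<open>F\<close> is arbitrary so that in the product case the law for
  \<open>\<psi>\<close> applies to \<open>F\<close> shifted by a factor of a cut of
  \<open>\<phi>\<close>.\<close>

lemma forest_cuts_left_counit:
  fixes F :: "forest \<Rightarrow> 'a::comm_monoid_add"
  shows "(\<Sum>c\<in>#forest_cuts \<phi>. if fst c = {#} then F (snd c) else 0) = F \<phi>"
proof (induction \<phi> arbitrary: F rule: forest_induct)
  case (graft a \<phi>)
  show ?case using graft[of "\<lambda>\<psi>. F {#Node a \<psi>#}"] by (simp add: sum_forest_cuts_Node cong: if_cong)
next
  case (union \<phi> \<psi>)
  have "(\<Sum>c\<in>#forest_cuts (\<phi> + \<psi>). if fst c = {#} then F (snd c) else 0) =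
    (\<Sum>c\<in>#forest_cuts \<phi>. if fst c = {#} then
       (\<Sum>d\<in>#forest_cuts \<psi>. if fst d = {#} then F (snd c + snd d) else 0) else 0)"
    unfolding sum_forest_cuts_union
    by (intro arg_cong[where f = sum_mset] image_mset_cong) (auto cong: if_cong)
  also have "\<dots> = F (\<phi> + \<psi>)"
    unfolding union.IH(2)[of "\<lambda>\<psi>. F (snd c + \<psi>)" for c] union.IH(1)[of "\<lambda>\<phi>. F (\<phi> + \<psi>)"] ..
  finally show ?case .
qed simp

lemma forest_cuts_right_counit:
  fixes F :: "forest \<Rightarrow> 'a::comm_monoid_add"
  shows "(\<Sum>c\<in>#forest_cuts \<phi>. if snd c = {#} then F (fst c) else 0) = F \<phi>"
proof (induction \<phi> arbitrary: F rule: forest_induct)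
  case (graft a \<phi>)
  show ?case by (simp add: sum_forest_cuts_Node)
next
  case (union \<phi> \<psi>)
  have "(\<Sum>c\<in>#forest_cuts (\<phi> + \<psi>). if snd c = {#} then F (fst c) else 0) =
    (\<Sum>c\<in>#forest_cuts \<phi>. if snd c = {#} then
       (\<Sum>d\<in>#forest_cuts \<psi>. if snd d = {#} then F (fst c + fst d) else 0) else 0)"
    unfolding sum_forest_cuts_union
    by (intro arg_cong[where f = sum_mset] image_mset_cong) (auto cong: if_cong)
  also have "\<dots> = F (\<phi> + \<psi>)"
    unfolding union.IH(2)[of "\<lambda>\<psi>. F (fst c + \<psi>)" for c] union.IH(1)[of "\<lambda>\<phi>. F (\<phi> + \<psi>)"] ..
  finally show ?case .
qed simp

text \<open>Stated for an arbitrary test function \<open>F\<close>, coassociativity is stable under products of forests,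
  and the cocycle identity \<open>sum_forest_cuts_Node\<close> reduces a grafted tree to the forest of its branches.\<close>
lemma forest_cuts_coassoc:
  fixes F :: "forest \<times> forest \<times> forest \<Rightarrow> 'a::comm_monoid_add"
  shows "(\<Sum>c\<in>#forest_cuts \<phi>. \<Sum>d\<in>#forest_cuts (fst c). F (fst d, snd d, snd c)) =
    (\<Sum>c\<in>#forest_cuts \<phi>. \<Sum>d\<in>#forest_cuts (snd c). F (fst c, fst d, snd d))"
proof (induction \<phi> arbitrary: F rule: forest_induct)
  case (graft a \<phi>)
  show ?case using graft[of "\<lambda>x. F (fst x, fst (snd x), {#Node a (snd (snd x))#})"]
    by (simp add: sum_forest_cuts_Node sum_mset.distrib add.assoc)
next
  case (union \<phi> \<psi>)
  let ?L = "\<lambda>\<phi> F. \<Sum>c\<in>#forest_cuts \<phi>. \<Sum>d\<in>#forest_cuts (fst c). F (fst d, snd d, snd c)"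
  let ?R = "\<lambda>\<phi> F. \<Sum>c\<in>#forest_cuts \<phi>. \<Sum>d\<in>#forest_cuts (snd c). F (fst c, fst d, snd d)"
  have "?L (\<phi> + \<psi>) F = ?L \<phi> (\<lambda>x. ?L \<psi> (\<lambda>y. F (x + y)))"
    unfolding sum_forest_cuts_union fst_add snd_add
    by (simp add: sum_mset.swap[of _ "forest_cuts \<psi>"])
  also have "\<dots> = ?R \<phi> (\<lambda>x. ?R \<psi> (\<lambda>y. F (x + y)))"
  proof -
    have "?L \<psi> (\<lambda>y. F (x + y)) = ?R \<psi> (\<lambda>y. F (x + y))" for x
      by (rule union.IH(2))
    then show ?thesis
      using union.IH(1)[of "\<lambda>x. ?R \<psi> (\<lambda>y. F (x + y))"] by (simp only:)
  qed
  also have "\<dots> = ?R (\<phi> + \<psi>) F"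
    unfolding sum_forest_cuts_union fst_add snd_add
    by (simp add: sum_mset.swap[of _ "forest_cuts \<psi>"] plus_prod_def)
  finally show ?case .
qed simp

section \<open>The convolution algebra and its exponential\<close>

lemma sum_mset_sum_swap:
  fixes g :: "'i \<Rightarrow> 'a \<Rightarrow> 'b::comm_monoid_add"
  shows "(\<Sum>x\<in>#M. \<Sum>i\<in>I. g i x) = (\<Sum>i\<in>I. \<Sum>x\<in>#M. g i x)"
  by (induction M) (auto simp: sum.distrib)

lemma sum_mset_mult_sum_mset:
  fixes f :: "'a \<Rightarrow> 'c::semiring_0"
  shows "(\<Sum>x\<in>#A. f x) * (\<Sum>y\<in>#B. g y) = (\<Sum>x\<in>#A. \<Sum>y\<in>#B. f x * g y)"
  by (simp add: sum_mset_distrib_left sum_mset_distrib_right sum_mset.swap[of _ A B])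

lemma conv_assoc: "conv (conv A B) C = conv A (conv B C)"
  using forest_cuts_coassoc[of "\<lambda>x. A (fst x) * B (fst (snd x)) * C (snd (snd x))"]
  by (simp add: conv_def fun_eq_iff sum_mset_distrib_left sum_mset_distrib_right mult.assoc)

lemma conv_unit_left [simp]: "conv unit_dual Y = Y"
proof
  fix \<theta>
  have "conv unit_dual Y \<theta> = (\<Sum>c\<in>#forest_cuts \<theta>. if fst c = {#} then Y (snd c) else 0)"
    unfolding conv_def unit_dual_def by (intro arg_cong[where f = sum_mset] image_mset_cong) auto
  then show "conv unit_dual Y \<theta> = Y \<theta>" by (simp add: forest_cuts_left_counit)
qed

lemma conv_pow_add: "conv (conv_pow a m) (conv_pow a n) = conv_pow a (m + n)"
  by (induction m) (simp_all add: conv_assoc)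

lemma conv_pow_uminus: "conv_pow (\<lambda>\<theta>. - a \<theta>) n \<theta> = (- 1) ^ n * conv_pow a n \<theta>"
proof (induction n arbitrary: \<theta>)
  case (Suc n)
  have "- a x * ((- 1) ^ n * y) = (- 1) ^ Suc n * (a x * y)" for x y by simp
  then show ?case by (simp only: conv_pow.simps conv_def Suc sum_mset_distrib_left)
qed simp

text \<open>A nonzero term of the n-fold convolution would split off \<open>n\<close> nonempty
  forests of at least one vertex each. Hence the exponential series is a finite sum at every
  forest.\<close>

lemma conv_pow_eq_0:
  assumes "a {#} = 0" and "fsize \<theta> < n"
  shows "conv_pow a n \<theta> = 0"
  using assms(2)
proof (induction n arbitrary: \<theta>)
  case (Suc n)
  have "a (fst c) * conv_pow a n (snd c) = 0" if "c \<in># forest_cuts \<theta>" for c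
  proof (cases "fst c = {#}")
    case False
    then have "fsize (fst c) > 0" by (metis fsize_eq_0_iff neq0_conv)
    then have "fsize (snd c) < n" using fsize_forest_cuts[OF that] Suc.prems by linarith
    then show ?thesis by (simp add: Suc.IH)
  qed (simp add: assms)
  then have "image_mset (\<lambda>c. a (fst c) * conv_pow a n (snd c)) (forest_cuts \<theta>) =
      image_mset (\<lambda>c. 0) (forest_cuts \<theta>)"
    by (intro image_mset_cong)
  then show ?case by (simp add: conv_def)
qed simp

lemma summable_conv_pow:
  assumes "a {#} = 0"
  shows "summable (\<lambda>n. norm (conv_pow a n \<theta> / fact n))"
  by (rule summable_finite[of "{..fsize \<theta>}"]) (auto simp: conv_pow_eq_0 assms)

text \<open>Convolution powers of \<open>a\<close> multiply by adding exponents, so the degree-n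
  term of the Cauchy product is \<open>(1 - 1)^n / n!\<close> times the n-th power of
  \<open>a\<close>; only \<open>n = 0\<close> survives.\<close>

lemma conv_exp_star_inverse:
  assumes "a {#} = 0"
  shows "conv (exp_star (\<lambda>\<theta>. - a \<theta>)) (exp_star a) = unit_dual"
proof
  fix \<theta>
  let ?b = "\<lambda>\<theta>. - a \<theta>" let ?C = "forest_cuts \<theta>"
  have b: "?b {#} = 0" using assms by simp
  define t where "t n c = (\<Sum>i\<le>n. (conv_pow ?b i (fst c) / fact i) *
      (conv_pow a (n - i) (snd c) / fact (n - i)))" for n and c :: "forest \<times> forest"
  have t: "(\<lambda>n. t n c) sums (exp_star ?b (fst c) * exp_star a (snd c))" for c
    unfolding exp_star_def t_def
    by (intro Cauchy_product_sums summable_conv_pow assms b)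
  \<comment> \<open>Stated for an arbitrary multiset \<open>C\<close>, so that induction
    interchanges the series with the finite sum over cuts.\<close>
  have "(\<lambda>n. \<Sum>c\<in>#C. t n c) sums (\<Sum>c\<in>#C. exp_star ?b (fst c) * exp_star a (snd c))" for C
    by (induction C) (auto intro: sums_add t)
  then have s: "(\<lambda>n. \<Sum>c\<in>#?C. t n c) sums conv (exp_star ?b) (exp_star a) \<theta>"
    by (simp add: conv_def)
  have "(\<Sum>c\<in>#?C. t n c) = (if n = 0 then unit_dual \<theta> else 0)" for n
  proof -
    have "(\<Sum>c\<in>#?C. t n c) = (\<Sum>i\<le>n. ((-1) ^ i / (fact i * fact (n - i))) *
        (\<Sum>c\<in>#?C. conv_pow a i (fst c) * conv_pow a (n - i) (snd c)))"
      unfolding t_def sum_mset_sum_swap sum_mset_distrib_left conv_pow_uminus by (simp add: mult.assoc)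
    also have "\<dots> = (\<Sum>i\<le>n. ((-1) ^ i / (fact i * fact (n - i))) * conv_pow a n \<theta>)"
      by (intro sum.cong refl) (simp add: conv_pow_add flip: conv_def)
    also have "\<dots> = (\<Sum>i\<le>n. of_nat (n choose i) * (-1) ^ i * 1 ^ (n - i)) * conv_pow a n \<theta> / fact n"
      by (simp add: sum_distrib_left sum_distrib_right sum_divide_distrib binomial_fact mult_ac)
    also have "\<dots> = (if n = 0 then unit_dual \<theta> else 0)"
      unfolding binomial_ring[of "-1 :: real" 1 n, symmetric] by (simp add: power_0_left)
    finally show ?thesis .
  qed
  then have "(\<lambda>n. \<Sum>c\<in>#?C. t n c) sums unit_dual \<theta>"
    using sums_single[of 0 "\<lambda>_. unit_dual \<theta>"] by simp
  with s show "conv (exp_star ?b) (exp_star a) \<theta> = unit_dual \<theta>"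
    by (rule sums_unique2)
qed

text \<open>The hypothesis makes \<open>a\<close> an infinitesimal character, a derivation with
  respect to the counit \<open>unit_dual\<close>. Its powers then obey a Leibniz rule, since each
  factor acts either on \<open>\<phi>\<close> or on \<open>\<psi>\<close>.\<close>

lemma conv_pow_union:
  assumes a: "\<And>\<phi> \<psi>. a (\<phi> + \<psi>) = unit_dual \<phi> * a \<psi> + a \<phi> * unit_dual \<psi>"
  shows "conv_pow a n (\<phi> + \<psi>) =
    (\<Sum>i\<le>n. of_nat (n choose i) * conv_pow a i \<phi> * conv_pow a (n - i) \<psi>)"
proof (induction n arbitrary: \<phi> \<psi>)
  case 0
  show ?case by (simp add: unit_dual_def)
next
  case (Suc n)
  let ?P = "conv_pow a"
  have "?P (Suc n) (\<phi> + \<psi>) = (\<Sum>c\<in>#forest_cuts \<phi>. \<Sum>d\<in>#forest_cuts \<psi>. \<Sum>i\<le>n. of_nat (n choose i) *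
     ((unit_dual (fst c) * ?P i (snd c)) * (a (fst d) * ?P (n - i) (snd d)) +
      (a (fst c) * ?P i (snd c)) * (unit_dual (fst d) * ?P (n - i) (snd d))))"
    by (simp add: conv_def sum_forest_cuts_union a Suc sum_distrib_left algebra_simps)
  also have "\<dots> = (\<Sum>i\<le>n. of_nat (n choose i) *
     (conv unit_dual (?P i) \<phi> * conv a (?P (n - i)) \<psi> + conv a (?P i) \<phi> * conv unit_dual (?P (n - i)) \<psi>))"
    unfolding sum_mset_sum_swap conv_def sum_mset_mult_sum_mset
    by (simp add: sum_mset_distrib_left sum_mset.distrib ring_distribs)
  also have "\<dots> = (\<Sum>i\<le>n. of_nat (n choose i) * (?P i \<phi> * ?P (Suc n - i) \<psi>)) +
      (\<Sum>i\<le>n. of_nat (n choose i) * (?P (Suc i) \<phi> * ?P (Suc n - Suc i) \<psi>))"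
    by (simp add: sum.distrib ring_distribs Suc_diff_le)
  \<comment> \<open>The added term \<open>i = Suc n\<close> vanishes since
    \<open>n choose Suc n\<close> is 0; this aligns both sums for Pascal's rule.\<close>
  also have "(\<Sum>i\<le>n. of_nat (n choose i) * (?P i \<phi> * ?P (Suc n - i) \<psi>)) =
      (\<Sum>i\<le>Suc n. of_nat (n choose i) * (?P i \<phi> * ?P (Suc n - i) \<psi>))"
    by simp
  also have "\<dots> = ?P 0 \<phi> * ?P (Suc n) \<psi> +
      (\<Sum>i\<le>n. of_nat (n choose Suc i) * (?P (Suc i) \<phi> * ?P (Suc n - Suc i) \<psi>))"
    by (subst sum.atMost_Suc_shift) simp
  finally show ?case
    by (subst sum.atMost_Suc_shift) (simp add: algebra_simps sum.distrib)
qed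

text \<open>Division by \<open>n!\<close> turns the Leibniz rule into the Cauchy product of two
  series, so an infinitesimal character exponentiates to a character.\<close>

lemma exp_star_union:
  assumes a: "\<And>\<phi> \<psi>. a (\<phi> + \<psi>) = unit_dual \<phi> * a \<psi> + a \<phi> * unit_dual \<psi>" and "a {#} = 0"
  shows "exp_star a (\<phi> + \<psi>) = exp_star a \<phi> * exp_star a \<psi>"
proof -
  have "exp_star a \<phi> * exp_star a \<psi> = (\<Sum>n. \<Sum>i\<le>n. (conv_pow a i \<phi> / fact i) *
      (conv_pow a (n - i) \<psi> / fact (n - i)))"
    unfolding exp_star_def by (intro Cauchy_product summable_conv_pow assms)
  also have "\<dots> = exp_star a (\<phi> + \<psi>)"
    unfolding exp_star_def conv_pow_union[OF a]
    by (intro suminf_cong) (auto simp: sum_divide_distrib binomial_fact intro!: sum.cong)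
  finally show ?thesis ..
qed

lemma exp_star_empty [simp]: "a {#} = 0 \<Longrightarrow> exp_star a {#} = 1"
  unfolding exp_star_def
  by (subst suminf_finite[of "{0}"]) (auto simp: conv_pow_eq_0 unit_dual_def)

section \<open>Truncated characters and inverses in the truncated group\<close>

lemma tree_span_empty: "tree_span l a \<Longrightarrow> a {#} = 0"
  by (auto simp: tree_span_def)

text \<open>A product of two nonempty forests is never a single tree, so a functional carried by
  trees vanishes on it and is an infinitesimal character.\<close>

lemma tree_span_union:
  assumes "tree_span l a"
  shows "a (\<phi> + \<psi>) = unit_dual \<phi> * a \<psi> + a \<phi> * unit_dual \<psi>"
proof (cases "\<phi> = {#} \<or> \<psi> = {#}")
  case True
  then show ?thesis using tree_span_empty[OF assms] by (auto simp: unit_dual_def)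
next
  case False
  then have "\<phi> + \<psi> \<noteq> {#\<tau>#}" for \<tau>
    by (metis add_is_1 size_eq_0_iff_empty size_single size_union zero_neq_one One_nat_def add_cancel_right_left)
  then have "a (\<phi> + \<psi>) = 0" using assms unfolding tree_span_def by metis
  with False show ?thesis by (simp add: unit_dual_def)
qed

lemma tree_span_uminus: "tree_span l a \<Longrightarrow> tree_span l (\<lambda>\<theta>. - a \<theta>)"
  by (simp add: tree_span_def)

text \<open>Truncation need not preserve multiplicativity beyond \<open>N\<close> vertices, so it is
  required only of products within that size.\<close>

definition trunc_character :: "nat \<Rightarrow> dual \<Rightarrow> bool" where
  "trunc_character N Y \<longleftrightarrow> Y {#} = 1 \<and>
     (\<forall>\<phi> \<psi>. fsize (\<phi> + \<psi>) \<le> N \<longrightarrow> Y (\<phi> + \<psi>) = Y \<phi> * Y \<psi>)"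

lemma trunc_character_Ggrp: "Y \<in> Ggrp N l \<Longrightarrow> trunc_character N Y"
  by (auto simp: Ggrp_def trunc_character_def trunc_def tree_span_empty
      intro!: exp_star_union tree_span_union)

lemma conv_trunc:
  assumes "fsize \<theta> \<le> N"
  shows "conv (trunc N Y) (trunc N Z) \<theta> = conv Y Z \<theta>"
  unfolding conv_def trunc_def
  by (intro arg_cong[where f = sum_mset] image_mset_cong)
    (use fsize_forest_cuts[of _ \<theta>] assms in force)

text \<open>Multiplicativity of Delta turns the sum over cuts of a product into a double sum, and
  degree counting keeps all products of factors within \<open>N\<close> vertices, where
  \<open>Y\<close> and \<open>Z\<close> are multiplicative.\<close>

lemma trunc_character_tprod:
  assumes Y: "trunc_character N Y" and Z: "trunc_character N Z"
  shows "trunc_character N (tprod N Y Z)"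
  unfolding trunc_character_def
proof (intro conjI allI impI)
  show "tprod N Y Z {#} = 1"
    using Y Z by (simp add: tprod_def trunc_def conv_def trunc_character_def)
  fix \<phi> \<psi> assume le: "fsize (\<phi> + \<psi>) \<le> N"
  have "conv Y Z (\<phi> + \<psi>) = (\<Sum>c\<in>#forest_cuts \<phi>. \<Sum>d\<in>#forest_cuts \<psi>.
      (Y (fst c) * Z (snd c)) * (Y (fst d) * Z (snd d)))"
    unfolding conv_def sum_forest_cuts_union
  proof (intro arg_cong[where f = sum_mset] image_mset_cong)
    fix c d assume "c \<in># forest_cuts \<phi>" "d \<in># forest_cuts \<psi>"
    then have "fsize (fst c + fst d) \<le> N" "fsize (snd c + snd d) \<le> N"
      using fsize_forest_cuts[of c \<phi>] fsize_forest_cuts[of d \<psi>] le by auto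
    then show "Y (fst (c + d)) * Z (snd (c + d)) = Y (fst c) * Z (snd c) * (Y (fst d) * Z (snd d))"
      using Y Z by (simp add: trunc_character_def)
  qed
  also have "\<dots> = conv Y Z \<phi> * conv Y Z \<psi>"
    unfolding conv_def sum_mset_mult_sum_mset ..
  finally show "tprod N Y Z (\<phi> + \<psi>) = tprod N Y Z \<phi> * tprod N Y Z \<psi>"
    using le by (simp add: tprod_def trunc_def)
qed

text \<open>Convolution with \<open>X\<close> is triangular in the degree: cuts with empty right
  factor return \<open>Y \<theta>\<close>, all others involve \<open>Y\<close> on smaller forests,
  where \<open>Y\<close> and \<open>Y'\<close> agree by induction.\<close>

lemma tprod_right_cancel:
  assumes X: "X {#} = 1" and eq: "tprod N Y X = tprod N Y' X" and "fsize \<theta> \<le> N"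
  shows "Y \<theta> = Y' \<theta>"
  using assms(3)
proof (induction "fsize \<theta>" arbitrary: \<theta> rule: less_induct)
  case less
  have "0 = conv Y X \<theta> - conv Y' X \<theta>"
    using fun_cong[OF eq, of \<theta>] less.prems by (simp add: tprod_def trunc_def)
  also have "\<dots> = (\<Sum>c\<in>#forest_cuts \<theta>. (Y (fst c) - Y' (fst c)) * X (snd c))"
  proof -
    have "(\<Sum>c\<in>#C. Y (fst c) * X (snd c)) - (\<Sum>c\<in>#C. Y' (fst c) * X (snd c)) =
        (\<Sum>c\<in>#C. (Y (fst c) - Y' (fst c)) * X (snd c))" for C
      by (induction C) (auto simp: algebra_simps)
    then show ?thesis by (simp add: conv_def)
  qed
  also have "\<dots> = (\<Sum>c\<in>#forest_cuts \<theta>. if snd c = {#} then Y (fst c) - Y' (fst c) else 0)"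
  proof (intro arg_cong[where f = sum_mset] image_mset_cong)
    fix c assume c: "c \<in># forest_cuts \<theta>"
    show "(Y (fst c) - Y' (fst c)) * X (snd c) = (if snd c = {#} then Y (fst c) - Y' (fst c) else 0)"
    proof (cases "snd c = {#}")
      case False
      then have "fsize (snd c) > 0" by (metis fsize_eq_0_iff neq0_conv)
      then have "fsize (fst c) < fsize \<theta>" using fsize_forest_cuts[OF c] by linarith
      with less show ?thesis by (simp add: False)
    qed (simp add: X)
  qed
  also have "\<dots> = Y \<theta> - Y' \<theta>"
    by (rule forest_cuts_right_counit)
  finally show ?case by simp
qed

text \<open>\<open>ginv\<close> is a definite description, so existence and uniqueness are both
  shown. The inverse is the truncated exponential of \<open>- a\<close>; uniqueness is cancellation
  up to \<open>N\<close> vertices, above which elements of the group vanish.\<close>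

lemma ginv:
  assumes "X \<in> Ggrp N l"
  shows "ginv N l X \<in> Ggrp N l" and "tprod N (ginv N l X) X = unit_dual"
proof -
  from assms obtain a where X: "X = trunc N (exp_star a)" and a: "tree_span l a"
    by (auto simp: Ggrp_def)
  note a0 = tree_span_empty[OF a]
  let ?Y = "trunc N (exp_star (\<lambda>\<theta>. - a \<theta>))"
  have "?Y \<in> Ggrp N l"
    using tree_span_uminus[OF a] unfolding Ggrp_def by blast
  moreover have "tprod N ?Y X = unit_dual"
    by (auto simp: fun_eq_iff tprod_def X trunc_def[of N "conv _ _"] conv_trunc
        conv_exp_star_inverse[of a, OF a0] unit_dual_def)
  moreover have "Y = Y'" if "Y \<in> Ggrp N l" "Y' \<in> Ggrp N l" "tprod N Y X = tprod N Y' X" for Y Y'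
  proof
    fix \<theta> show "Y \<theta> = Y' \<theta>"
    proof (cases "fsize \<theta> \<le> N")
      case True
      with tprod_right_cancel[OF _ that(3)] show ?thesis by (simp add: X trunc_def a0)
    next
      case False
      with that(1,2) show ?thesis by (auto simp: Ggrp_def trunc_def)
    qed
  qed
  ultimately have "\<exists>!Y. Y \<in> Ggrp N l \<and> tprod N Y X = unit_dual" by metis
  from theI'[OF this] show "ginv N l X \<in> Ggrp N l" "tprod N (ginv N l X) X = unit_dual"
    by (simp_all add: ginv_def)
qed

lemma trunc_character_incr:
  assumes "X s \<in> Ggrp N l" "X t \<in> Ggrp N l"
  shows "trunc_character N (incr N l X s t)"
  using trunc_character_Ggrp[OF ginv(1)[OF assms(1)]] trunc_character_Ggrp[OF assms(2)]
  by (simp add: incr_def trunc_character_tprod)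

text \<open>Covers the diagonal, since \<open>branched_rough_path\<close> bounds increments for
  \<open>s < t\<close> only.\<close>

lemma incr_refl: "X s \<in> Ggrp N l \<Longrightarrow> incr N l X s s = unit_dual"
  by (simp add: incr_def ginv)

text \<open>Identifies the coefficient of a forest with the product of tree coefficients that
  Taylor's formula produces.\<close>

lemma trunc_character_prod_mset:
  assumes "trunc_character N Y" "fsize \<phi> \<le> N"
  shows "Y \<phi> = (\<Prod>t\<in>#\<phi>. Y {#t#})"
  using assms(2)
proof (induction \<phi>)
  case (add t \<phi>)
  then have "Y ({#t#} + \<phi>) = Y {#t#} * Y \<phi>"
    using assms(1) by (simp add: trunc_character_def del: union_mset_add_mset_left)
  with add show ?case by simp
qed (use assms in \<open>simp add: trunc_character_def\<close>)

section \<open>Iterated derivatives\<close>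

text \<open>The differentiability and continuity conditions of \<open>C_gamma\<close>, separated
  from its Hoelder bound and with the order as a parameter.\<close>

definition C_times :: "nat \<Rightarrow> ('a::real_normed_vector \<Rightarrow> 'b::real_normed_vector) \<Rightarrow> bool" where
  "C_times k f \<longleftrightarrow>
     (\<forall>hs. length hs < k \<longrightarrow> (\<forall>x. (\<lambda>y. nderiv f y hs) differentiable (at x))) \<and>
     (\<forall>hs. length hs \<le> k \<longrightarrow> continuous_on UNIV (\<lambda>y. nderiv f y hs))"

lemma nderiv_has_derivative:
  assumes "C_times k f" "length hs < k"
  shows "((\<lambda>y. nderiv f y hs) has_derivative (\<lambda>h. nderiv f x (h # hs))) (at x)"
  using assms by (simp add: C_times_def frechet_derivative_works)

text \<open>The outermost direction enters linearly because a Frechet derivative is linear. For an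
  inner slot, the linear relation holds at every point by induction and is differentiated;
  uniqueness of derivatives carries it outwards.\<close>

lemma nderiv_linear:
  assumes f: "C_times k f" and "length hs + length hs' < k"
  shows "linear (\<lambda>h. nderiv f x (hs @ h # hs'))"
  using assms(2)
proof (induction hs arbitrary: x)
  case Nil
  then show ?case
    using has_derivative_linear[OF nderiv_has_derivative[OF f, of hs' x]] by simp
next
  case (Cons g hs)
  have D: "((\<lambda>y. nderiv f y (hs @ h # hs')) has_derivative
      (\<lambda>g. nderiv f x (g # hs @ h # hs'))) (at x)" for h
    by (rule nderiv_has_derivative[OF f]) (use Cons.prems in simp)
  have lin: "linear (\<lambda>h. nderiv f y (hs @ h # hs'))" for y
    using Cons by simp
  show ?case
  proof (rule linearI)
    fix h h'
    have "(\<lambda>y. nderiv f y (hs @ (h + h') # hs')) =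
        (\<lambda>y. nderiv f y (hs @ h # hs') + nderiv f y (hs @ h' # hs'))"
      using linear_add[OF lin] by auto
    with has_derivative_add[OF D D, of h h']
    have "((\<lambda>y. nderiv f y (hs @ (h + h') # hs')) has_derivative
        (\<lambda>g. nderiv f x (g # hs @ h # hs') + nderiv f x (g # hs @ h' # hs'))) (at x)"
      by simp
    from has_derivative_unique[OF D this]
    show "nderiv f x ((g # hs) @ (h + h') # hs') =
        nderiv f x ((g # hs) @ h # hs') + nderiv f x ((g # hs) @ h' # hs')"
      by (simp add: fun_eq_iff)
  next
    fix c h
    have "(\<lambda>y. nderiv f y (hs @ (c *\<^sub>R h) # hs')) = (\<lambda>y. c *\<^sub>R nderiv f y (hs @ h # hs'))"
      using linear_scale[OF lin] by auto
    with has_derivative_scaleR_right[OF D, of c h]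
    have "((\<lambda>y. nderiv f y (hs @ (c *\<^sub>R h) # hs')) has_derivative
        (\<lambda>g. c *\<^sub>R nderiv f x (g # hs @ h # hs'))) (at x)"
      by simp
    from has_derivative_unique[OF D this]
    show "nderiv f x ((g # hs) @ (c *\<^sub>R h) # hs') = c *\<^sub>R nderiv f x ((g # hs) @ h # hs')"
      by (simp add: fun_eq_iff)
  qed
qed

text \<open>The prefix \<open>hs\<close> collects directions already fixed. Expanding one free
  direction in \<open>Basis\<close> leads to finitely many longer prefixes; without free directions,
  continuity on the compact closure of \<open>B\<close> gives the bound.\<close>

lemma nderiv_bounded:
  fixes f :: "'a::euclidean_space \<Rightarrow> 'b::real_normed_vector"
  assumes f: "C_times k f" and B: "bounded B" and "length hs + n \<le> k"
  shows "\<exists>M\<ge>0. \<forall>x\<in>B. \<forall>hs'. length hs' = n \<longrightarrow>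
    norm (nderiv f x (hs @ hs')) \<le> M * prod_list (map norm hs')"
  using assms(3)
proof (induction n arbitrary: hs)
  case 0
  have "continuous_on (closure B) (\<lambda>y. nderiv f y hs)"
    using f 0 by (auto simp: C_times_def intro: continuous_on_subset)
  then have "bounded ((\<lambda>y. nderiv f y hs) ` closure B)"
    using B by (intro compact_imp_bounded compact_continuous_image) auto
  then obtain M where "\<forall>y\<in>closure B. norm (nderiv f y hs) \<le> M"
    by (auto simp: bounded_iff)
  then show ?case
    using closure_subset[of B] by (intro exI[of _ "max 0 M"]) (auto simp: le_max_iff_disj)
next
  case (Suc n)
  have "\<forall>b. \<exists>M\<ge>0. \<forall>x\<in>B. \<forall>hs'. length hs' = n \<longrightarrow>
      norm (nderiv f x ((hs @ [b]) @ hs')) \<le> M * prod_list (map norm hs')"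
    using Suc.prems by (intro allI Suc.IH) simp
  then obtain M where M0: "\<And>b. M b \<ge> 0" and
    M: "\<And>b x hs'. x \<in> B \<Longrightarrow> length hs' = n \<Longrightarrow>
      norm (nderiv f x (hs @ b # hs')) \<le> M b * prod_list (map norm hs')"
    by simp metis
  show ?case
  proof (intro exI[of _ "\<Sum>b\<in>Basis. M b"] conjI ballI allI impI)
    show "0 \<le> (\<Sum>b\<in>Basis. M b)" by (simp add: sum_nonneg M0)
    fix x hs' assume x: "x \<in> B" and len: "length (hs' :: 'a list) = Suc n"
    then obtain h t where hs': "hs' = h # t" "length t = n" by (auto simp: length_Suc_conv)
    have lin: "linear (\<lambda>h. nderiv f x (hs @ h # t))"
      by (rule nderiv_linear[OF f]) (use Suc.prems hs' in simp)
    have P: "0 \<le> prod_list (map norm t)" by (induction t) auto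
    have "nderiv f x (hs @ hs') = nderiv f x (hs @ (\<Sum>b\<in>Basis. (h \<bullet> b) *\<^sub>R b) # t)"
      by (simp add: hs' euclidean_representation)
    also have "\<dots> = (\<Sum>b\<in>Basis. (h \<bullet> b) *\<^sub>R nderiv f x (hs @ b # t))"
      by (simp add: linear_sum[OF lin] linear_scale[OF lin])
    also have "norm \<dots> \<le> (\<Sum>b\<in>Basis. norm h * (M b * prod_list (map norm t)))"
      by (intro order.trans[OF norm_sum] sum_mono)
        (auto intro!: mult_mono M x hs' Basis_le_norm)
    also have "\<dots> = (\<Sum>b\<in>Basis. M b) * prod_list (map norm hs')"
      by (simp add: hs' sum_distrib_left sum_distrib_right mult_ac)
    finally show "norm (nderiv f x (hs @ hs')) \<le> (\<Sum>b\<in>Basis. M b) * prod_list (map norm hs')" .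
  qed
qed

section \<open>Symmetry of higher derivatives\<close>

lemma has_real_derivative_along_line:
  fixes g :: "'a::real_normed_vector \<Rightarrow> real"
  assumes "(g has_derivative g') (at (x + s *\<^sub>R u))"
  shows "((\<lambda>s. g (x + s *\<^sub>R u)) has_real_derivative g' u) (at s)"
proof -
  have "((\<lambda>s. x + s *\<^sub>R u) has_derivative (\<lambda>r. r *\<^sub>R u)) (at s)"
    by (auto intro!: derivative_eq_intros)
  from has_derivative_compose[OF this assms]
  have "((\<lambda>s. g (x + s *\<^sub>R u)) has_derivative (\<lambda>r. g' (r *\<^sub>R u))) (at s)" .
  moreover have "(\<lambda>r. g' (r *\<^sub>R u)) = (*) (g' u)"
    using linear_scale[OF has_derivative_linear[OF assms]] by auto
  ultimately show ?thesis by (simp add: has_field_derivative_def)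
qed

text \<open>The mean value theorem is applied twice: along \<open>u\<close> to the difference of
  \<open>g\<close> at two points \<open>r v\<close> apart, then along \<open>v\<close> to the
  derivative in direction \<open>u\<close>.\<close>

lemma second_difference_mean_value:
  fixes g :: "'a::real_normed_vector \<Rightarrow> real"
  assumes g: "\<And>y. (g has_derivative (\<lambda>h. D h y)) (at y)"
    and Du: "\<And>y. (D u has_derivative (\<lambda>h. E h y)) (at y)" and "r > 0"
  shows "\<exists>a\<in>{0<..<r}. \<exists>b\<in>{0<..<r}. g (x + r *\<^sub>R u + r *\<^sub>R v) - g (x + r *\<^sub>R u) - g (x + r *\<^sub>R v) + g x
    = r * r * E v (x + a *\<^sub>R u + b *\<^sub>R v)"
proof -
  let ?\<phi> = "\<lambda>s. g ((x + r *\<^sub>R v) + s *\<^sub>R u) - g (x + s *\<^sub>R u)"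
  have "(?\<phi> has_real_derivative D u ((x + r *\<^sub>R v) + s *\<^sub>R u) - D u (x + s *\<^sub>R u)) (at s)" for s
    by (intro DERIV_diff has_real_derivative_along_line g)
  from MVT2[OF \<open>r > 0\<close> this] obtain a where a: "a \<in> {0<..<r}"
    "?\<phi> r - ?\<phi> 0 = r * (D u ((x + r *\<^sub>R v) + a *\<^sub>R u) - D u (x + a *\<^sub>R u))"
    by auto
  have "((\<lambda>s. D u ((x + a *\<^sub>R u) + s *\<^sub>R v)) has_real_derivative E v ((x + a *\<^sub>R u) + s *\<^sub>R v)) (at s)" for s
    by (intro has_real_derivative_along_line Du)
  from MVT2[OF \<open>r > 0\<close> this] obtain b where b: "b \<in> {0<..<r}"
    "D u ((x + a *\<^sub>R u) + r *\<^sub>R v) - D u (x + a *\<^sub>R u) = r * E v ((x + a *\<^sub>R u) + b *\<^sub>R v)"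
    by auto
  show ?thesis
    by (rule bexI[OF _ a(1)], rule bexI[OF _ b(1)]) (use a(2) b(2) in \<open>simp add: algebra_simps\<close>)
qed

text \<open>The second difference is symmetric in \<open>u\<close> and \<open>v\<close>, so both
  mixed derivatives take a common value at points, possibly different, arbitrarily close to
  \<open>x\<close>; continuity forces equality at \<open>x\<close>.\<close>

lemma symmetric_second_derivative:
  fixes g :: "'a::real_normed_vector \<Rightarrow> real"
  assumes g: "\<And>y. (g has_derivative (\<lambda>h. D h y)) (at y)"
    and Du: "\<And>y. (D u has_derivative (\<lambda>h. E h y)) (at y)"
    and Dv: "\<And>y. (D v has_derivative (\<lambda>h. F h y)) (at y)"
    and "isCont (E v) x" "isCont (F u) x"
  shows "E v x = F u x"
proof (rule ccontr)
  assume "E v x \<noteq> F u x"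
  define e where "e = \<bar>E v x - F u x\<bar> / 2"
  have "e > 0" using \<open>E v x \<noteq> F u x\<close> by (simp add: e_def)
  obtain d1 where d1: "d1 > 0" "\<And>y. dist y x < d1 \<Longrightarrow> \<bar>E v y - E v x\<bar> < e"
    using \<open>isCont (E v) x\<close> \<open>e > 0\<close> unfolding continuous_at_eps_delta dist_real_def by metis
  obtain d2 where d2: "d2 > 0" "\<And>y. dist y x < d2 \<Longrightarrow> \<bar>F u y - F u x\<bar> < e"
    using \<open>isCont (F u) x\<close> \<open>e > 0\<close> unfolding continuous_at_eps_delta dist_real_def by metis
  \<comment> \<open>This step size keeps every \<open>x + a u + b v\<close> with \<open>a, b\<close>
    in the open interval from 0 to \<open>r\<close> inside both neighbourhoods; the summand 1 keeps
    the denominator positive.\<close>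
  define r where "r = min d1 d2 / (norm u + norm v + 1)"
  have n: "norm u + norm v + 1 > 0" by (smt (verit) norm_ge_zero)
  then have "r > 0" using d1 d2 by (simp add: r_def)
  have close: "dist (x + a *\<^sub>R u + b *\<^sub>R v) x < min d1 d2" if "a \<in> {0<..<r}" "b \<in> {0<..<r}" for a b
  proof -
    have "dist (x + a *\<^sub>R u + b *\<^sub>R v) x \<le> a * norm u + b * norm v"
      using that norm_triangle_ineq[of "a *\<^sub>R u" "b *\<^sub>R v"] by (simp add: dist_norm add.assoc)
    also have "\<dots> \<le> r * norm u + r * norm v"
      using that by (intro add_mono mult_right_mono) auto
    also have "\<dots> < r * (norm u + norm v + 1)"
      using \<open>r > 0\<close> by (simp add: algebra_simps)
    also have "\<dots> = min d1 d2" using n by (simp add: r_def)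
    finally show ?thesis .
  qed
  obtain a b where ab: "a \<in> {0<..<r}" "b \<in> {0<..<r}"
    "g (x + r *\<^sub>R u + r *\<^sub>R v) - g (x + r *\<^sub>R u) - g (x + r *\<^sub>R v) + g x
      = r * r * E v (x + a *\<^sub>R u + b *\<^sub>R v)"
    using second_difference_mean_value[OF g Du \<open>r > 0\<close>] by blast
  obtain a' b' where ab': "a' \<in> {0<..<r}" "b' \<in> {0<..<r}"
    "g (x + r *\<^sub>R v + r *\<^sub>R u) - g (x + r *\<^sub>R v) - g (x + r *\<^sub>R u) + g x
      = r * r * F u (x + a' *\<^sub>R v + b' *\<^sub>R u)"
    using second_difference_mean_value[OF g Dv \<open>r > 0\<close>] by blast
  have eqs: "x + r *\<^sub>R v + r *\<^sub>R u = x + r *\<^sub>R u + r *\<^sub>R v" "x + a' *\<^sub>R v + b' *\<^sub>R u = x + b' *\<^sub>R u + a' *\<^sub>R v"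
    by (simp_all add: algebra_simps)
  have "r * r * E v (x + a *\<^sub>R u + b *\<^sub>R v) = r * r * F u (x + b' *\<^sub>R u + a' *\<^sub>R v)"
    using ab(3) ab'(3)[unfolded eqs] by linarith
  then have "E v (x + a *\<^sub>R u + b *\<^sub>R v) = F u (x + b' *\<^sub>R u + a' *\<^sub>R v)"
    using \<open>r > 0\<close> by simp
  then show False
    using d1(2)[of "x + a *\<^sub>R u + b *\<^sub>R v"] d2(2)[of "x + b' *\<^sub>R u + a' *\<^sub>R v"]
      close[OF ab(1,2)] close[OF ab'(2,1)] unfolding e_def by (smt (verit) field_sum_of_halves)
qed

lemma nderiv_swap:
  fixes f :: "'a::real_normed_vector \<Rightarrow> real"
  assumes f: "C_times k f" and len: "length hs + 2 \<le> k"
  shows "nderiv f x (v # u # hs) = nderiv f x (u # v # hs)"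
proof -
  have D: "((\<lambda>y. nderiv f y hs') has_derivative (\<lambda>h. nderiv f y (h # hs'))) (at y)"
    if "length hs' \<le> Suc (length hs)" for y hs'
    using len that by (intro nderiv_has_derivative[OF f]) simp
  have K: "isCont (\<lambda>y. nderiv f y (v # u # hs)) x" for u v
    using f len unfolding C_times_def by (simp add: continuous_on_eq_continuous_at del: nderiv.simps)
  show ?thesis
    by (rule symmetric_second_derivative[where D = "\<lambda>h y. nderiv f y (h # hs)" and
          E = "\<lambda>h y. nderiv f y (h # u # hs)" and F = "\<lambda>h y. nderiv f y (h # v # hs)",
          OF D D D K K]) simp_all
qed

text \<open>Agreement is asked at every \<open>y\<close> because the new outer direction
  differentiates in \<open>y\<close>. Inner directions can thus be permuted underneath further
  derivatives.\<close>

lemma nderiv_Cons_cong: "(\<And>y. nderiv f y hs = nderiv f y hs') \<Longrightarrow> nderiv f x (h # hs) = nderiv f x (h # hs')"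
  by simp

lemma nderiv_move_to_front:
  fixes f :: "'a::real_normed_vector \<Rightarrow> real"
  assumes f: "C_times k f"
  shows "length hs + length hs' < k \<Longrightarrow> nderiv f x (hs @ h # hs') = nderiv f x (h # hs @ hs')"
proof (induction hs arbitrary: x)
  case (Cons g hs)
  have "nderiv f x (g # hs @ h # hs') = nderiv f x (g # h # hs @ hs')"
    by (rule nderiv_Cons_cong, rule Cons.IH) (use Cons.prems in simp)
  also have "\<dots> = nderiv f x (h # g # hs @ hs')"
    by (rule nderiv_swap[OF f]) (use Cons.prems in simp)
  finally show ?case by simp
qed simp

text \<open>The head of \<open>hs\<close> is located in \<open>hs'\<close> and moved to its front;
  the remaining directions are permuted by induction at every base point.\<close>

lemma nderiv_permute:
  fixes f :: "'a::real_normed_vector \<Rightarrow> real"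
  assumes f: "C_times k f"
  shows "mset hs = mset hs' \<Longrightarrow> length hs \<le> k \<Longrightarrow> nderiv f x hs = nderiv f x hs'"
proof (induction hs arbitrary: hs' x)
  case (Cons h hs)
  then have "h \<in> set hs'" by (metis list.set_intros(1) set_mset_mset)
  then obtain as bs where hs': "hs' = as @ h # bs" by (auto simp: in_set_conv_decomp)
  with Cons.prems have m: "mset hs = mset (as @ bs)" by simp
  then have "length hs = length as + length bs" by (metis length_append size_mset)
  with Cons.prems have len: "length as + length bs < k" by simp
  have "nderiv f x (h # hs) = nderiv f x (h # as @ bs)"
    by (rule nderiv_Cons_cong, rule Cons.IH[OF m]) (use Cons.prems in simp)
  also have "\<dots> = nderiv f x hs'"
    unfolding hs' by (rule nderiv_move_to_front[OF f len, symmetric])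
  finally show ?case .
qed simp

section \<open>Taylor's formula and its multilinear expansion\<close>

text \<open>This is the Maclaurin formula for \<open>f\<close> along the segment from
  \<open>x\<close> to \<open>x + h\<close>, with Lagrange remainder.\<close>

lemma nderiv_taylor:
  fixes f :: "'a::real_normed_vector \<Rightarrow> real"
  assumes f: "C_times k f" and "0 < n" "n \<le> k"
  shows "\<exists>r\<in>{0<..<1}. f (x + h) = (\<Sum>m<n. nderiv f x (replicate m h) / fact m) +
    nderiv f (x + r *\<^sub>R h) (replicate n h) / fact n"
proof -
  let ?D = "\<lambda>m s. nderiv f (x + s *\<^sub>R h) (replicate m h)"
  have "DERIV (?D m) s :> ?D (Suc m) s" if "m < n" for m s
    unfolding replicate_Suc
    by (rule has_real_derivative_along_line, rule nderiv_has_derivative[OF f])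
      (use that assms in simp)
  then have "\<exists>r>0. r < 1 \<and> ?D 0 1 = (\<Sum>m<n. ?D m 0 / fact m * 1 ^ m) + ?D n r / fact n * 1 ^ n"
    by (intro Maclaurin) (use assms in auto)
  then show ?thesis by (simp add: Bex_def)
qed

text \<open>Linearity is used one slot at a time: the prefix \<open>hs\<close> holds the slots
  already expanded, and the words \<open>xs\<close> record the chosen summands.\<close>

lemma nderiv_expand:
  fixes f :: "'a::real_normed_vector \<Rightarrow> real"
  assumes f: "C_times k f" and I: "finite I"
  shows "length hs + n \<le> k \<Longrightarrow> nderiv f x (hs @ replicate n (\<Sum>i\<in>I. c i *\<^sub>R w i)) =
    (\<Sum>xs | set xs \<subseteq> I \<and> length xs = n. prod_list (map c xs) * nderiv f x (hs @ map w xs))"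
proof (induction n arbitrary: hs)
  case 0
  have "{xs. set xs \<subseteq> I \<and> xs = []} = {[]}" by auto
  then show ?case by simp
next
  case (Suc n)
  let ?H = "\<Sum>i\<in>I. c i *\<^sub>R w i" and ?L = "\<lambda>n. {xs. set xs \<subseteq> I \<and> length xs = n}"
  have lin: "linear (\<lambda>h. nderiv f x (hs @ h # replicate n ?H))"
    by (rule nderiv_linear[OF f]) (use Suc.prems in simp)
  have "nderiv f x (hs @ replicate (Suc n) ?H) =
      (\<Sum>i\<in>I. c i * nderiv f x ((hs @ [w i]) @ replicate n ?H))"
    by (simp add: linear_sum[OF lin] linear_scale[OF lin])
  also have "\<dots> = (\<Sum>i\<in>I. \<Sum>xs\<in>?L n. prod_list (map c (i # xs)) * nderiv f x (hs @ map w (i # xs)))"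
    using Suc.prems by (subst Suc.IH) (auto simp: sum_distrib_left mult.assoc)
  also have "\<dots> = (\<Sum>(xs, i)\<in>?L n \<times> I. prod_list (map c (i # xs)) * nderiv f x (hs @ map w (i # xs)))"
    by (subst sum.swap) (simp add: sum.cartesian_product)
  also have "\<dots> = (\<Sum>xs\<in>?L (Suc n). prod_list (map c xs) * nderiv f x (hs @ map w xs))"
    unfolding lists_length_Suc_eq
    by (subst sum.reindex) (auto simp: inj_on_def case_prod_unfold)
  finally show ?case .
qed

text \<open>The weight counts the orderings of \<open>M\<close>. It is the origin of the factorials
  of multiplicities in the symmetry factor.\<close>

lemma sum_lists_eq_sum_multisets:
  fixes g :: "'a multiset \<Rightarrow> real"
  assumes I: "finite I"
  shows "(\<Sum>xs | set xs \<subseteq> I \<and> length xs = n. g (mset xs)) =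
    (\<Sum>M | set_mset M \<subseteq> I \<and> size M = n. fact n / (\<Prod>x\<in>set_mset M. fact (count M x)) * g M)"
proof -
  let ?L = "{xs. set xs \<subseteq> I \<and> length xs = n}" and ?M = "{M. set_mset M \<subseteq> I \<and> size M = n}"
  have im: "mset ` ?L = ?M"
  proof (intro equalityI subsetI)
    fix M assume "M \<in> ?M"
    moreover obtain xs where "mset xs = M" using ex_mset by blast
    ultimately show "M \<in> mset ` ?L" by (intro image_eqI[of _ _ xs]) auto
  qed auto
  have "(\<Sum>xs\<in>?L. g (mset xs)) = (\<Sum>M\<in>mset ` ?L. \<Sum>xs | xs \<in> ?L \<and> mset xs = M. g (mset xs))"
    by (rule sum.image_gen) (simp add: finite_lists_length_eq I)
  also have "\<dots> = (\<Sum>M\<in>?M. fact n / (\<Prod>x\<in>set_mset M. fact (count M x)) * g M)"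
    unfolding im
  proof (intro sum.cong refl)
    fix M assume M: "M \<in> ?M"
    then have "{xs. xs \<in> ?L \<and> mset xs = M} = permutations_of_multiset M"
      by (auto simp: permutations_of_multiset_def)
    then have "(\<Sum>xs | xs \<in> ?L \<and> mset xs = M. g (mset xs)) = card (permutations_of_multiset M) * g M"
      by (simp add: permutations_of_multiset_def)
    moreover have "real (card (permutations_of_multiset M)) = fact n / (\<Prod>x\<in>set_mset M. fact (count M x))"
      using arg_cong[OF card_permutations_of_multiset_aux[of M], of real] M
      by (simp add: field_simps)
    ultimately show "(\<Sum>xs | xs \<in> ?L \<and> mset xs = M. g (mset xs)) =
        fact n / (\<Prod>x\<in>set_mset M. fact (count M x)) * g M" by simp
  qed
  finally show ?thesis .
qed

lemma C_gamma_imp_C_times: "C_gamma \<gamma> f \<Longrightarrow> C_times (nat (\<lceil>\<gamma>\<rceil> - 1)) f"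
  by (simp add: C_gamma_def C_times_def Let_def)

text \<open>Let \<open>k\<close> be the largest integer below \<open>\<gamma>\<close>. If
  \<open>k = N\<close>, Hoelder continuity of the top derivative gives the exponent
  \<open>\<gamma>\<close>; if \<open>k > N\<close>, the Lagrange remainder gives
  \<open>N + 1\<close>. The minimum covers both cases.\<close>

lemma C_gamma_taylor:
  fixes f :: "'a::euclidean_space \<Rightarrow> real"
  assumes f: "C_gamma \<gamma> f" and N: "1 \<le> N" "real N < \<gamma>"
  shows "\<exists>C\<ge>0. \<forall>x h. norm x \<le> R \<and> norm (x + h) \<le> R \<longrightarrow>
    \<bar>f (x + h) - (\<Sum>m\<le>N. nderiv f x (replicate m h) / fact m)\<bar> \<le> C * norm h powr min \<gamma> (real N + 1)"
proof -
  define k where "k = nat (\<lceil>\<gamma>\<rceil> - 1)"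
  have Ck: "C_times k f" using C_gamma_imp_C_times[OF f] by (simp add: k_def)
  have "N \<le> k" using N unfolding k_def by linarith
  let ?T = "\<lambda>x h. \<Sum>m\<le>N. nderiv f x (replicate m h) / fact m"
  have seg: "norm (x + r *\<^sub>R h) \<le> R" if "norm x \<le> R" "norm (x + h) \<le> R" "r \<in> {0<..<1}" for x h :: 'a and r
  proof -
    have "x + r *\<^sub>R h = (1 - r) *\<^sub>R x + r *\<^sub>R (x + h)" by (simp add: algebra_simps)
    also have "\<dots> \<in> cball 0 R"
      by (rule convexD[OF convex_cball]) (use that in auto)
    finally show ?thesis by simp
  qed
  show ?thesis
  proof (cases "k = N")
    case True
    then have \<gamma>: "\<gamma> \<le> real N + 1" using N unfolding k_def by linarith
    obtain C where C: "\<And>x y hs. x \<in> cball 0 R \<Longrightarrow> y \<in> cball 0 R \<Longrightarrow> length hs = N \<Longrightarrow>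
        \<bar>nderiv f x hs - nderiv f y hs\<bar> \<le> C * dist x y powr (\<gamma> - real N) * prod_list (map norm hs)"
      using f bounded_cball[of "0::'a" R] True
      unfolding C_gamma_def k_def[symmetric] Let_def real_norm_def by metis
    show ?thesis
    proof (intro exI[of _ "\<bar>C\<bar>"] conjI allI impI)
      fix x h :: 'a assume x: "norm x \<le> R \<and> norm (x + h) \<le> R"
      \<comment> \<open>The Lagrange remainder sits at order \<open>N\<close> itself; subtracting
        the Taylor term of order \<open>N\<close> at \<open>x\<close> leaves a difference of
        derivatives for the Hoelder bound.\<close>
      obtain r where r: "r \<in> {0<..<1}"
        "f (x + h) = (\<Sum>m<N. nderiv f x (replicate m h) / fact m) +
          nderiv f (x + r *\<^sub>R h) (replicate N h) / fact N"
        using nderiv_taylor[OF Ck, of N x h] N \<open>N \<le> k\<close> by auto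
      have "\<bar>f (x + h) - ?T x h\<bar> =
          \<bar>nderiv f (x + r *\<^sub>R h) (replicate N h) - nderiv f x (replicate N h)\<bar> / fact N"
        unfolding r(2) lessThan_Suc_atMost[symmetric] by (simp add: diff_divide_distrib[symmetric])
      also have "\<dots> \<le> \<bar>nderiv f (x + r *\<^sub>R h) (replicate N h) - nderiv f x (replicate N h)\<bar> / 1"
        by (intro divide_left_mono) auto
      also have "\<dots> \<le> C * dist (x + r *\<^sub>R h) x powr (\<gamma> - real N) * norm h ^ N"
        using C[of "x + r *\<^sub>R h" x "replicate N h"] seg[of x h r] x r by simp
      also have "\<dots> \<le> \<bar>C\<bar> * norm h powr (\<gamma> - real N) * norm h ^ N"
        using r N by (intro mult_mono powr_mono2) (auto simp: dist_norm mult_left_le_one_le)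
      also have "\<dots> = \<bar>C\<bar> * norm h powr \<gamma>"
        using N by (cases "h = 0") (auto simp: powr_realpow[symmetric] powr_add[symmetric] mult.assoc)
      finally show "\<bar>f (x + h) - ?T x h\<bar> \<le> \<bar>C\<bar> * norm h powr min \<gamma> (real N + 1)"
        using \<gamma> by simp
    qed simp
  next
    case False
    with \<open>N \<le> k\<close> have "Suc N \<le> k" by simp
    then have \<gamma>: "real N + 1 \<le> \<gamma>" unfolding k_def by linarith
    obtain M where M: "M \<ge> 0" "\<And>x hs. x \<in> cball 0 R \<Longrightarrow> length hs = Suc N \<Longrightarrow>
        \<bar>nderiv f x hs\<bar> \<le> M * prod_list (map norm hs)"
      using nderiv_bounded[OF Ck bounded_cball[of 0 R], of "[]" "Suc N"] \<open>Suc N \<le> k\<close> by auto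
    show ?thesis
    proof (intro exI[of _ M] conjI allI impI M)
      fix x h :: 'a assume x: "norm x \<le> R \<and> norm (x + h) \<le> R"
      obtain r where r: "r \<in> {0<..<1}"
        "f (x + h) = (\<Sum>m<Suc N. nderiv f x (replicate m h) / fact m) +
          nderiv f (x + r *\<^sub>R h) (replicate (Suc N) h) / fact (Suc N)"
        using nderiv_taylor[OF Ck, of "Suc N" x h] \<open>Suc N \<le> k\<close> by blast
      have "\<bar>f (x + h) - ?T x h\<bar> = \<bar>nderiv f (x + r *\<^sub>R h) (replicate (Suc N) h)\<bar> / fact (Suc N)"
        unfolding r(2) lessThan_Suc_atMost by simp
      also have "\<dots> \<le> \<bar>nderiv f (x + r *\<^sub>R h) (replicate (Suc N) h)\<bar> / 1"
        by (intro divide_left_mono fact_ge_1) auto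
      also have "\<dots> \<le> M * norm h ^ Suc N"
        using M(2)[of "x + r *\<^sub>R h" "replicate (Suc N) h"] seg[of x h r] x r
        by (simp del: nderiv.simps replicate.simps)
      also have "norm h ^ Suc N = norm h powr min \<gamma> (real N + 1)"
        using \<gamma> powr_realpow'[of "norm h" "Suc N"] by (simp add: min_absorb2 add.commute)
      finally show "\<bar>f (x + h) - ?T x h\<bar> \<le> M * norm h powr min \<gamma> (real N + 1)" .
    qed
  qed
qed

section \<open>Power bounds for two-parameter functions\<close>

text \<open>This is \<open>F s t = O((t - s)^e)\<close> on the simplex. Since
  \<open>0 powr e = 0\<close>, it forces \<open>F\<close> to vanish on the diagonal, even for
  \<open>e = 0\<close>.\<close>

definition power_bounded :: "real \<Rightarrow> real \<Rightarrow> (real \<Rightarrow> real \<Rightarrow> 'a::real_normed_vector) \<Rightarrow> bool" where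
  "power_bounded T e F \<longleftrightarrow>
     (\<exists>C\<ge>0. \<forall>s t. 0 \<le> s \<and> s \<le> t \<and> t \<le> T \<longrightarrow> norm (F s t) \<le> C * (t - s) powr e)"

lemma power_boundedI:
  assumes "\<And>s t. 0 \<le> s \<Longrightarrow> s \<le> t \<Longrightarrow> t \<le> T \<Longrightarrow> norm (F s t) \<le> C * (t - s) powr e"
  shows "power_bounded T e F"
  unfolding power_bounded_def
proof (intro exI[of _ "\<bar>C\<bar>"] conjI allI impI)
  fix s t assume "0 \<le> s \<and> s \<le> t \<and> t \<le> T"
  then have "norm (F s t) \<le> C * (t - s) powr e" using assms by blast
  also have "\<dots> \<le> \<bar>C\<bar> * (t - s) powr e" by (intro mult_right_mono) auto
  finally show "norm (F s t) \<le> \<bar>C\<bar> * (t - s) powr e" .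
qed simp

lemma power_bounded_iff:
  "power_bounded T e F \<longleftrightarrow>
     (\<exists>C. \<forall>s t. 0 \<le> s \<and> s \<le> t \<and> t \<le> T \<longrightarrow> norm (F s t) \<le> C * (t - s) powr e)"
  by (metis power_boundedI power_bounded_def)

lemma power_boundedE:
  assumes "power_bounded T e F"
  obtains C where "C \<ge> 0"
    "\<And>s t. 0 \<le> s \<Longrightarrow> s \<le> t \<Longrightarrow> t \<le> T \<Longrightarrow> norm (F s t) \<le> C * (t - s) powr e"
  using assms unfolding power_bounded_def by metis

lemma power_bounded_mono:
  assumes F: "power_bounded T e F"
    and le: "\<And>s t. 0 \<le> s \<Longrightarrow> s \<le> t \<Longrightarrow> t \<le> T \<Longrightarrow> norm (G s t) \<le> M * norm (F s t)" and "M \<ge> 0"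
  shows "power_bounded T e G"
proof -
  obtain C where C: "C \<ge> 0"
    "\<And>s t. 0 \<le> s \<Longrightarrow> s \<le> t \<Longrightarrow> t \<le> T \<Longrightarrow> norm (F s t) \<le> C * (t - s) powr e"
    using F by (rule power_boundedE) blast
  show ?thesis
  proof (rule power_boundedI[of _ _ "M * C"])
    fix s t assume st: "0 \<le> s" "s \<le> t" "t \<le> T"
    have "norm (G s t) \<le> M * norm (F s t)" by (rule le[OF st])
    also have "\<dots> \<le> M * (C * (t - s) powr e)" by (rule mult_left_mono[OF C(2)[OF st] \<open>M \<ge> 0\<close>])
    finally show "norm (G s t) \<le> M * C * (t - s) powr e" by (simp add: mult.assoc)
  qed
qed

lemma power_bounded_cong:
  assumes "power_bounded T e F" "\<And>s t. 0 \<le> s \<Longrightarrow> s \<le> t \<Longrightarrow> t \<le> T \<Longrightarrow> G s t = F s t"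
  shows "power_bounded T e G"
  by (rule power_bounded_mono[OF assms(1), of _ 1]) (use assms(2) in auto)

lemma power_bounded_weaken:
  assumes F: "power_bounded T e F" and e: "e' \<le> e"
  shows "power_bounded T e' F"
proof -
  obtain C where C: "C \<ge> 0"
    "\<And>s t. 0 \<le> s \<Longrightarrow> s \<le> t \<Longrightarrow> t \<le> T \<Longrightarrow> norm (F s t) \<le> C * (t - s) powr e"
    using F by (rule power_boundedE) blast
  show ?thesis
  proof (rule power_boundedI[of _ _ "C * T powr (e - e')"])
    fix s t assume st: "0 \<le> s" "s \<le> t" "t \<le> T"
    have "norm (F s t) \<le> C * (t - s) powr e" by (rule C(2)[OF st])
    also have "(t - s) powr e = (t - s) powr (e - e') * (t - s) powr e'"
      by (simp add: powr_add[symmetric])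
    also have "C * \<dots> \<le> C * (T powr (e - e') * (t - s) powr e')"
      using st e C(1) by (intro mult_left_mono mult_right_mono powr_mono2) auto
    finally show "norm (F s t) \<le> C * T powr (e - e') * (t - s) powr e'" by (simp add: mult.assoc)
  qed
qed

lemma power_bounded_add:
  assumes "power_bounded T e F" "power_bounded T e G"
  shows "power_bounded T e (\<lambda>s t. F s t + G s t)"
proof -
  obtain C where C: "\<And>s t. 0 \<le> s \<Longrightarrow> s \<le> t \<Longrightarrow> t \<le> T \<Longrightarrow> norm (F s t) \<le> C * (t - s) powr e"
    using assms(1) by (rule power_boundedE) blast
  obtain D where D: "\<And>s t. 0 \<le> s \<Longrightarrow> s \<le> t \<Longrightarrow> t \<le> T \<Longrightarrow> norm (G s t) \<le> D * (t - s) powr e"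
    using assms(2) by (rule power_boundedE) blast
  show ?thesis
  proof (rule power_boundedI[of _ _ "C + D"])
    fix s t assume st: "0 \<le> s" "s \<le> t" "t \<le> T"
    show "norm (F s t + G s t) \<le> (C + D) * (t - s) powr e"
      using norm_triangle_ineq[of "F s t" "G s t"] C[OF st] D[OF st]
      unfolding distrib_right by linarith
  qed
qed

lemma power_bounded_sum:
  assumes "finite I" "\<And>i. i \<in> I \<Longrightarrow> power_bounded T e (F i)"
  shows "power_bounded T e (\<lambda>s t. \<Sum>i\<in>I. F i s t)"
  using assms
proof (induction I)
  case empty
  show ?case by (rule power_boundedI[of _ _ 0]) simp
next
  case (insert i I)
  then show ?case by (simp add: power_bounded_add)
qed

lemma power_bounded_mult:
  fixes F G :: "real \<Rightarrow> real \<Rightarrow> real"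
  assumes "power_bounded T e F" "power_bounded T e' G"
  shows "power_bounded T (e + e') (\<lambda>s t. F s t * G s t)"
proof -
  obtain C where C: "C \<ge> 0" "\<And>s t. 0 \<le> s \<Longrightarrow> s \<le> t \<Longrightarrow> t \<le> T \<Longrightarrow> norm (F s t) \<le> C * (t - s) powr e"
    using assms(1) by (rule power_boundedE) blast
  obtain D where D: "\<And>s t. 0 \<le> s \<Longrightarrow> s \<le> t \<Longrightarrow> t \<le> T \<Longrightarrow> norm (G s t) \<le> D * (t - s) powr e'"
    using assms(2) by (rule power_boundedE) blast
  show ?thesis
  proof (rule power_boundedI[of _ _ "C * D"])
    fix s t assume st: "0 \<le> s" "s \<le> t" "t \<le> T"
    have "norm (F s t * G s t) \<le> (C * (t - s) powr e) * (D * (t - s) powr e')"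
      unfolding norm_mult using C(1) by (intro mult_mono C(2)[OF st] D[OF st]) auto
    then show "norm (F s t * G s t) \<le> C * D * (t - s) powr (e + e')"
      by (simp add: powr_add mult_ac)
  qed
qed

lemma power_bounded_norm_powr:
  assumes "power_bounded T e F" "\<beta> > 0"
  shows "power_bounded T (e * \<beta>) (\<lambda>s t. norm (F s t) powr \<beta>)"
proof -
  obtain C where C: "C \<ge> 0" "\<And>s t. 0 \<le> s \<Longrightarrow> s \<le> t \<Longrightarrow> t \<le> T \<Longrightarrow> norm (F s t) \<le> C * (t - s) powr e"
    using assms(1) by (rule power_boundedE) blast
  show ?thesis
  proof (rule power_boundedI[of _ _ "C powr \<beta>"])
    fix s t assume st: "0 \<le> s" "s \<le> t" "t \<le> T"
    have "norm (F s t) powr \<beta> \<le> (C * (t - s) powr e) powr \<beta>"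
      using assms(2) by (intro powr_mono2 C(2)[OF st]) auto
    then show "norm (norm (F s t) powr \<beta>) \<le> C powr \<beta> * (t - s) powr (e * \<beta>)"
      using C(1) by (simp add: powr_mult powr_powr)
  qed
qed

text \<open>Exponents add along the trees. The empty forest is excluded because its product 1 does
  not vanish on the diagonal, whereas \<open>0 powr 0 = 0\<close>.\<close>

lemma power_bounded_prod_mset:
  fixes Y :: "tree \<Rightarrow> real \<Rightarrow> real \<Rightarrow> real"
  assumes "\<phi> \<noteq> {#}" "\<And>t. t \<in># \<phi> \<Longrightarrow> power_bounded T (real (tsize t) / p) (Y t)"
  shows "power_bounded T (real (fsize \<phi>) / p) (\<lambda>s u. \<Prod>t\<in>#\<phi>. Y t s u)"
  using assms
proof (induction \<phi>)
  case (add t \<phi>)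
  show ?case
  proof (cases "\<phi> = {#}")
    case False
    have "power_bounded T (real (tsize t) / p + real (fsize \<phi>) / p) (\<lambda>s u. Y t s u * (\<Prod>t\<in>#\<phi>. Y t s u))"
      by (intro power_bounded_mult add.IH False add.prems(2)) auto
    then show ?thesis by (simp add: add_divide_distrib)
  qed (use add in simp)
qed simp

section \<open>Forest expansions\<close>

definition rde_trees :: "nat \<Rightarrow> nat \<Rightarrow> tree set" where
  "rde_trees l N = {t. tree_ok l t \<and> tsize t \<le> N}"

lemma tsize_le_fsize: "t \<in># \<phi> \<Longrightarrow> tsize t \<le> fsize \<phi>"
  by (induction \<phi>) auto

lemma size_le_fsize: "size \<phi> \<le> fsize \<phi>"
proof (induction \<phi>)
  case (add t \<phi>)
  then show ?case using tsize_pos[of t] by (simp del: tsize_pos)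
qed simp

lemma finite_multisets_size_le: "finite I \<Longrightarrow> finite {M. set_mset M \<subseteq> I \<and> size M \<le> n}"
proof (rule finite_subset[of _ "mset ` {xs. set xs \<subseteq> I \<and> length xs \<le> n}"])
  show "{M. set_mset M \<subseteq> I \<and> size M \<le> n} \<subseteq> mset ` {xs. set xs \<subseteq> I \<and> length xs \<le> n}"
  proof
    fix M assume "M \<in> {M. set_mset M \<subseteq> I \<and> size M \<le> n}"
    moreover obtain xs where "mset xs = M" using ex_mset by blast
    ultimately show "M \<in> mset ` {xs. set xs \<subseteq> I \<and> length xs \<le> n}"
      by (intro image_eqI[of _ _ xs]) auto
  qed
qed (simp add: finite_lists_length_le)

text \<open>A tree consists of one of \<open>l\<close> root labels and a multiset of at most
  \<open>N\<close> smaller trees, so finiteness passes from \<open>N\<close> to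
  \<open>Suc N\<close>.\<close>

lemma finite_rde_trees: "finite (rde_trees l N)"
proof (induction N)
  case 0
  have "rde_trees l 0 = {}" by (auto simp: rde_trees_def)
  then show ?case by simp
next
  case (Suc N)
  have "rde_trees l (Suc N) \<subseteq>
      (\<lambda>(a, M). Node a M) ` ({1..l} \<times> {M. set_mset M \<subseteq> rde_trees l N \<and> size M \<le> N})"
  proof
    fix t assume t: "t \<in> rde_trees l (Suc N)"
    obtain a M where tM: "t = Node a M" by (cases t)
    from t have M: "fsize M \<le> N" "1 \<le> a" "a \<le> l" "\<And>u. u \<in># M \<Longrightarrow> tree_ok l u"
      by (auto simp: rde_trees_def tM tsize_Node simp del: tsize.simps)
    then have "set_mset M \<subseteq> rde_trees l N" "size M \<le> N"
      using size_le_fsize[of M] by (auto simp: rde_trees_def dest: tsize_le_fsize)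
    with M show "t \<in> (\<lambda>(a, M). Node a M) ` ({1..l} \<times> {M. set_mset M \<subseteq> rde_trees l N \<and> size M \<le> N})"
      by (auto simp: tM)
  qed
  then show ?case
    by (rule finite_subset) (intro finite_imageI finite_cartesian_product finite_multisets_size_le Suc, simp)
qed

text \<open>Makes the number of trees explicit, which is the order of the derivative in
  \<open>diffop\<close> and hence the order of a Taylor term.\<close>

lemma rde_forests_eq:
  "rde_forests l N = {\<phi>. set_mset \<phi> \<subseteq> rde_trees l N \<and> size \<phi> \<in> {1..N} \<and> fsize \<phi> \<le> N}"
proof -
  have "1 \<le> fsize \<phi> \<longleftrightarrow> 1 \<le> size \<phi>" for \<phi>
    using fsize_eq_0_iff[of \<phi>] size_eq_0_iff_empty[of \<phi>] by linarith
  then show ?thesis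
    using size_le_fsize by (fastforce simp: rde_forests_def forest_ok_def rde_trees_def
        dest: tsize_le_fsize intro: order_trans)
qed

lemma finite_rde_forests: "finite (rde_forests l N)"
  by (rule finite_subset[OF _ finite_multisets_size_le[OF finite_rde_trees[of l N], of N]])
    (auto simp: rde_forests_eq)

section \<open>Symmetry factors and local bounds on the differential operators\<close>

lemma mset_list_of_mset [simp]: "mset (list_of_mset M) = M"
  unfolding list_of_mset_def by (rule someI_ex) (rule ex_mset)

lemma length_list_of_mset [simp]: "length (list_of_mset M) = size M"
  by (metis mset_list_of_mset size_mset)

lemma set_list_of_mset [simp]: "set (list_of_mset M) = set_mset M"
  by (metis mset_list_of_mset set_mset_mset)

lemma list_of_mset_single [simp]: "list_of_mset {#x#} = [x]"
  using mset_list_of_mset[of "{#x#}"] by (simp only: mset_single_iff)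

lemma tsigma_pos: "tsigma t > 0"
proof (induction t)
  case (Node a ch)
  then have "0 < prod_mset (image_mset tsigma ch)"
    by (induction ch) auto
  then show ?case by (simp add: prod_pos)
qed

lemma fsigma_eq: "fsigma \<phi> = (\<Prod>\<tau>\<in>set_mset \<phi>. fact (count \<phi> \<tau>)) * (\<Prod>\<tau>\<in>#\<phi>. tsigma \<tau>)"
  by (simp add: fsigma_def)

lemma C_times_le: "C_times k f \<Longrightarrow> n \<le> k \<Longrightarrow> C_times n f"
  by (auto simp: C_times_def)

lemma bounded_prod_norm:
  assumes "\<And>g. g \<in> set gs \<Longrightarrow> bounded (g ` B)"
  shows "\<exists>M\<ge>0. \<forall>x\<in>B. prod_list (map norm (map (\<lambda>g. g x) gs)) \<le> M"
  using assms
proof (induction gs)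
  case Nil
  show ?case by (intro exI[of _ 1]) auto
next
  case (Cons g gs)
  then obtain M where M: "M \<ge> 0" "\<forall>x\<in>B. prod_list (map norm (map (\<lambda>g. g x) gs)) \<le> M"
    by auto
  obtain K where K: "\<forall>x\<in>B. norm (g x) \<le> K" "K > 0"
    using Cons.prems[of g] by (auto simp: bounded_pos)
  have "0 \<le> prod_list (map norm (map (\<lambda>g. g x) gs))" for x by (induction gs) auto
  then show ?case using M K by (intro exI[of _ "K * M"]) (auto intro!: mult_mono)
qed

lemma bounded_nderiv_map:
  fixes f :: "'a::euclidean_space \<Rightarrow> 'b::real_normed_vector"
  assumes f: "C_times k f" and B: "bounded B" and "length gs \<le> k"
    and "\<And>g. g \<in> set gs \<Longrightarrow> bounded (g ` B)"
  shows "bounded ((\<lambda>x. nderiv f x (map (\<lambda>g. g x) gs)) ` B)"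
proof -
  obtain M where M: "M \<ge> 0" "\<forall>x\<in>B. \<forall>hs. length hs = length gs \<longrightarrow>
      norm (nderiv f x hs) \<le> M * prod_list (map norm hs)"
    using nderiv_bounded[OF f B, of "[]" "length gs"] assms(3) by auto
  obtain K where K: "K \<ge> 0" "\<forall>x\<in>B. prod_list (map norm (map (\<lambda>g. g x) gs)) \<le> K"
    using bounded_prod_norm[of gs B] assms(4) by auto
  have "norm (nderiv f x (map (\<lambda>g. g x) gs)) \<le> M * K" if "x \<in> B" for x
  proof -
    have "norm (nderiv f x (map (\<lambda>g. g x) gs)) \<le> M * prod_list (map norm (map (\<lambda>g. g x) gs))"
      using M(2)[rule_format, OF that, of "map (\<lambda>g. g x) gs"] by simp
    also have "\<dots> \<le> M * K" using K(2) that M(1) by (intro mult_left_mono) auto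
    finally show ?thesis .
  qed
  then show ?thesis by (auto simp: bounded_iff)
qed

lemma bounded_scaleR_const_image:
  fixes f :: "'a \<Rightarrow> 'b::real_normed_vector"
  shows "bounded (f ` B) \<Longrightarrow> bounded ((\<lambda>x. c *\<^sub>R f x) ` B)"
  using bounded_scaling[of "f ` B" c] by (simp add: image_image)

text \<open>The root of such a tree has fewer than \<open>N\<close> branches, so its field is
  differentiated within the available order; the branches lie again in \<open>rde_trees l N\<close>
  and are bounded by induction.\<close>

lemma bounded_vfield:
  fixes V :: "nat \<Rightarrow> 'a::euclidean_space \<Rightarrow> 'a"
  assumes V: "\<And>a. a \<in> {1..l} \<Longrightarrow> C_times N (V a)" and B: "bounded B"
  shows "t \<in> rde_trees l N \<Longrightarrow> bounded (vfield V t ` B)"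
proof (induction t)
  case (Node a ch)
  then have ch: "fsize ch < N" "a \<in> {1..l}" "\<And>u. u \<in># ch \<Longrightarrow> tree_ok l u"
    by (auto simp: rde_trees_def tsize_Node simp del: tsize.simps)
  have "u \<in> rde_trees l N" if "u \<in># ch" for u
    using ch that tsize_le_fsize[OF that] by (auto simp: rde_trees_def)
  with Node.IH have "bounded (vfield V u ` B)" if "u \<in># ch" for u
    using that by blast
  then show ?case
    unfolding vfield.simps
    by (intro bounded_scaleR_const_image bounded_nderiv_map[OF V[OF ch(2)] B])
      (use ch size_le_fsize[of ch] in auto)
qed

lemma bounded_diffop:
  fixes V :: "nat \<Rightarrow> 'a::euclidean_space \<Rightarrow> 'a" and f :: "'a \<Rightarrow> 'b::real_normed_vector"
  assumes V: "\<And>a. a \<in> {1..l} \<Longrightarrow> C_times N (V a)" and f: "C_times N f" and B: "bounded B"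
    and \<phi>: "set_mset \<phi> \<subseteq> rde_trees l N" "size \<phi> \<le> N"
  shows "bounded (diffop V \<phi> f ` B)"
proof -
  have "bounded ((\<lambda>x. nderiv f x (map (\<lambda>g. g x) (map (vfield V) (list_of_mset \<phi>)))) ` B)"
    using \<phi> by (intro bounded_nderiv_map[OF f B]) (auto intro!: bounded_vfield[OF V B])
  then show ?thesis
    unfolding diffop_def [abs_def] by (intro bounded_scaleR_const_image) (simp add: o_def)
qed

section \<open>Expansion of linear functions\<close>

text \<open>The Frechet derivative of \<open>f\<close> is \<open>f\<close> itself at every base
  point, hence constant in that point, and a second differentiation gives 0.\<close>

lemma nderiv_bounded_linear:
  assumes "bounded_linear f"
  shows "nderiv f x hs = (case hs of [] \<Rightarrow> f x | [h] \<Rightarrow> f h | _ \<Rightarrow> 0)"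
proof (induction hs arbitrary: x)
  case (Cons h hs)
  have f: "frechet_derivative f (at x) = f" for x
    using frechet_derivative_at[OF bounded_linear.has_derivative[OF assms has_derivative_ident]] by simp
  show ?case unfolding nderiv.simps Cons.IH
    by (cases hs; cases "tl hs") (auto simp: f frechet_derivative_const)
qed simp

lemma diffop_single:
  "bounded_linear f \<Longrightarrow> diffop V {#t#} f x = f ((1 / real (tsigma t)) *\<^sub>R vfield V t x)"
  by (simp add: diffop_def fsigma_eq nderiv_bounded_linear linear_scale bounded_linear.linear
      del: nderiv.simps)

lemma diffop_bounded_linear_eq_0:
  assumes "bounded_linear f" "size \<phi> \<ge> 2"
  shows "diffop V \<phi> f x = 0"
proof -
  obtain h h' hs where "map (\<lambda>\<tau>. vfield V \<tau> x) (list_of_mset \<phi>) = h # h' # hs"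
    using assms(2) by (metis (no_types, lifting) One_nat_def Suc_1 Suc_le_length_iff length_list_of_mset length_map)
  then show ?thesis by (simp add: diffop_def nderiv_bounded_linear[OF assms(1)] del: nderiv.simps)
qed

text \<open>Only the one-tree forests contribute to the expansion of a linear function.\<close>
lemma sum_diffop_bounded_linear:
  assumes f: "bounded_linear f"
  shows "(\<Sum>\<phi>\<in>rde_forests l N. Y \<phi> *\<^sub>R diffop V \<phi> f x) =
    f (\<Sum>t\<in>rde_trees l N. (Y {#t#} / real (tsigma t)) *\<^sub>R vfield V t x)"
proof -
  have "(\<Sum>\<phi>\<in>rde_forests l N. Y \<phi> *\<^sub>R diffop V \<phi> f x) =
      (\<Sum>\<phi>\<in>(\<lambda>t. {#t#}) ` rde_trees l N. Y \<phi> *\<^sub>R diffop V \<phi> f x)"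
  proof (rule sum.mono_neutral_right[OF finite_rde_forests])
    show "(\<lambda>t. {#t#}) ` rde_trees l N \<subseteq> rde_forests l N"
      by (auto simp: Suc_le_eq rde_forests_def rde_trees_def forest_ok_def)
    show "\<forall>\<phi>\<in>rde_forests l N - (\<lambda>t. {#t#}) ` rde_trees l N. Y \<phi> *\<^sub>R diffop V \<phi> f x = 0"
    proof
      fix \<phi> assume \<phi>: "\<phi> \<in> rde_forests l N - (\<lambda>t. {#t#}) ` rde_trees l N"
      then have "\<phi> \<noteq> {#}" "\<And>t. \<phi> \<noteq> {#t#}" by (auto simp: rde_forests_eq)
      then have "size \<phi> \<ge> 2"
        by (metis One_nat_def Suc_1 less_2_cases not_less size_1_singleton_mset size_eq_0_iff_empty)
      then show "Y \<phi> *\<^sub>R diffop V \<phi> f x = 0" by (simp add: diffop_bounded_linear_eq_0[OF f])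
    qed
  qed
  also have "\<dots> = (\<Sum>t\<in>rde_trees l N. Y {#t#} *\<^sub>R f ((1 / real (tsigma t)) *\<^sub>R vfield V t x))"
    by (subst sum.reindex) (auto simp: diffop_single[OF f] inj_on_def)
  also have "\<dots> = f (\<Sum>t\<in>rde_trees l N. (Y {#t#} / real (tsigma t)) *\<^sub>R vfield V t x)"
    using f by (simp add: linear_sum linear_scale bounded_linear.linear)
  finally show ?thesis .
qed

section \<open>Taylor terms as sums over forests\<close>

text \<open>The derivative expands over words of trees, and words with the same forest are
  collected. The number of orderings cancels \<open>m!\<close> and leaves the factorials of
  \<open>fsigma\<close>.\<close>

lemma taylor_term_eq_sum_diffop:
  fixes f :: "'a::real_normed_vector \<Rightarrow> real"
  assumes f: "C_times k f" and "m \<le> k"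
  shows "nderiv f x (replicate m (\<Sum>t\<in>rde_trees l N. (y t / real (tsigma t)) *\<^sub>R vfield V t x)) / fact m =
    (\<Sum>\<phi> | set_mset \<phi> \<subseteq> rde_trees l N \<and> size \<phi> = m. (\<Prod>t\<in>#\<phi>. y t) * diffop V \<phi> f x)"
proof -
  define c where "c t = y t / real (tsigma t)" for t
  define w where "w t = vfield V t x" for t
  define g where "g \<phi> = (\<Prod>t\<in>#\<phi>. c t) * nderiv f x (map w (list_of_mset \<phi>))" for \<phi>
  have "nderiv f x (replicate m (\<Sum>t\<in>rde_trees l N. c t *\<^sub>R w t)) =
      (\<Sum>xs | set xs \<subseteq> rde_trees l N \<and> length xs = m. prod_list (map c xs) * nderiv f x (map w xs))"
    using nderiv_expand[OF f finite_rde_trees[of l N], of "[]" m x c w] assms(2) by simp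
  also have "\<dots> = (\<Sum>xs | set xs \<subseteq> rde_trees l N \<and> length xs = m. g (mset xs))"
  proof (intro sum.cong refl)
    fix xs assume xs: "xs \<in> {xs. set xs \<subseteq> rde_trees l N \<and> length xs = m}"
    \<comment> \<open>By symmetry of the derivatives, the ordering chosen by
      \<open>list_of_mset\<close> is immaterial.\<close>
    have "nderiv f x (map w xs) = nderiv f x (map w (list_of_mset (mset xs)))"
      by (rule nderiv_permute[OF f]) (use xs assms(2) in auto)
    then show "prod_list (map c xs) * nderiv f x (map w xs) = g (mset xs)"
      by (simp add: g_def flip: prod_mset_prod_list mset_map)
  qed
  also have "\<dots> = (\<Sum>\<phi> | set_mset \<phi> \<subseteq> rde_trees l N \<and> size \<phi> = m.
      fact m / (\<Prod>t\<in>set_mset \<phi>. fact (count \<phi> t)) * g \<phi>)"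
    by (rule sum_lists_eq_sum_multisets[OF finite_rde_trees])
  also have "\<dots> = (\<Sum>\<phi> | set_mset \<phi> \<subseteq> rde_trees l N \<and> size \<phi> = m.
      fact m * ((\<Prod>t\<in>#\<phi>. y t) * diffop V \<phi> f x))"
  proof (intro sum.cong refl)
    fix \<phi> :: forest
    \<comment> \<open>The weights \<open>1 / tsigma t\<close> multiply to the remaining part of
      \<open>1 / fsigma \<phi>\<close>; the normalisation of the fields stays inside
      \<open>vfield\<close>.\<close>
    have "(\<Prod>t\<in>#\<phi>. c t) = (\<Prod>t\<in>#\<phi>. y t) / real (\<Prod>t\<in>#\<phi>. tsigma t)"
      by (induction \<phi>) (auto simp: c_def)
    then show "fact m / (\<Prod>t\<in>set_mset \<phi>. fact (count \<phi> t)) * g \<phi> =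
        fact m * ((\<Prod>t\<in>#\<phi>. y t) * diffop V \<phi> f x)"
      by (simp add: g_def diffop_def fsigma_eq w_def[abs_def])
  qed
  finally show ?thesis
    by (simp add: c_def w_def sum_distrib_left[symmetric])
qed

text \<open>The mean value theorem on a segment, which stays in the ball by convexity, where the
  first derivative is bounded.\<close>

lemma C_times_lipschitz:
  fixes f :: "'a::euclidean_space \<Rightarrow> real"
  assumes f: "C_times k f" "1 \<le> k"
  shows "\<exists>L\<ge>0. \<forall>x\<in>cball 0 R. \<forall>y\<in>cball 0 R. \<bar>f y - f x\<bar> \<le> L * norm (y - x)"
proof -
  obtain M where "M \<ge> 0" and M': "\<forall>x\<in>cball 0 R. \<forall>hs. length hs = 1 \<longrightarrow>
      norm (nderiv f x hs) \<le> M * prod_list (map norm hs)"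
    using nderiv_bounded[OF f(1) bounded_cball[of 0 R], of "[]" "1"] f(2) by auto
  have M: "\<bar>nderiv f x [h]\<bar> \<le> M * norm h" if "x \<in> cball 0 R" for x h
    using M'[rule_format, OF that, of "[h]"] by (simp del: nderiv.simps)
  show ?thesis
  proof (intro exI[of _ M] conjI ballI \<open>M \<ge> 0\<close>)
    fix x y :: 'a assume xy: "x \<in> cball 0 R" "y \<in> cball 0 R"
    obtain r where r: "r \<in> {0<..<1}" "f (x + (y - x)) = f x + nderiv f (x + r *\<^sub>R (y - x)) [y - x]"
      using nderiv_taylor[OF f(1), of 1 x "y - x"] f(2) by (auto simp del: nderiv.simps(2))
    have "x + r *\<^sub>R (y - x) = (1 - r) *\<^sub>R x + r *\<^sub>R y" by (simp add: algebra_simps)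
    also have "\<dots> \<in> cball 0 R"
      by (rule convexD[OF convex_cball]) (use xy r in auto)
    finally show "\<bar>f y - f x\<bar> \<le> M * norm (y - x)"
      using M[of "x + r *\<^sub>R (y - x)" "y - x"] r(2) by (simp del: nderiv.simps)
  qed
qed

section \<open>Davie and Bailleul solutions\<close>

lemma power_bounded_incr:
  assumes X: "branched_rough_path l p T X" and \<tau>: "\<tau> \<in> rde_trees l (nat \<lfloor>p\<rfloor>)"
  shows "power_bounded T (real (tsize \<tau>) / p) (\<lambda>s t. incr (nat \<lfloor>p\<rfloor>) l X s t {#\<tau>#})"
proof -
  have "forest_ok l {#\<tau>#} \<and> fsize {#\<tau>#} \<le> nat \<lfloor>p\<rfloor>"
    using \<tau> by (simp add: forest_ok_def rde_trees_def)
  then obtain C where C: "\<And>s t. 0 \<le> s \<Longrightarrow> s < t \<Longrightarrow> t \<le> T \<Longrightarrow>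
      \<bar>incr (nat \<lfloor>p\<rfloor>) l X s t {#\<tau>#}\<bar> \<le> C * (t - s) powr (real (fsize {#\<tau>#}) / p)"
    using X unfolding branched_rough_path_def by metis
  show ?thesis
  proof (rule power_boundedI[of _ _ C])
    fix s t assume st: "0 \<le> s" "s \<le> t" "t \<le> T"
    show "norm (incr (nat \<lfloor>p\<rfloor>) l X s t {#\<tau>#}) \<le> C * (t - s) powr (real (tsize \<tau>) / p)"
    proof (cases "s = t")
      case True
      then have "X t \<in> Ggrp (nat \<lfloor>p\<rfloor>) l" using X st by (auto simp: branched_rough_path_def)
      with True show ?thesis by (simp add: incr_refl unit_dual_def)
    next
      case False
      with C[of s t] st show ?thesis by simp
    qed
  qed
qed

text \<open>The forest sum of Davie's expansion, reduced to single trees. The divisor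
  \<open>tsigma t\<close> is the factor \<open>fsigma {#t#}\<close> of \<open>diffop\<close>, in
  addition to the one inside \<open>vfield\<close>.\<close>

definition rde_increment ::
  "nat \<Rightarrow> nat \<Rightarrow> (nat \<Rightarrow> 'a::real_normed_vector \<Rightarrow> 'a) \<Rightarrow> dual \<Rightarrow> 'a \<Rightarrow> 'a" where
  "rde_increment l N V Y x = (\<Sum>t\<in>rde_trees l N. (Y {#t#} / real (tsigma t)) *\<^sub>R vfield V t x)"

text \<open>Every tree has a vertex, so \<open>1 / p\<close> is the smallest exponent. The base
  point \<open>x\<close> is general: it is constant while the solution is not yet known to be
  bounded, and the solution itself afterwards.\<close>

lemma power_bounded_rde_increment:
  fixes V :: "nat \<Rightarrow> 'a::euclidean_space \<Rightarrow> 'a" and p :: real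
  defines "N \<equiv> nat \<lfloor>p\<rfloor>"
  assumes X: "branched_rough_path l p T X" and "p > 0"
    and V: "\<And>a. a \<in> {1..l} \<Longrightarrow> C_times N (V a)"
    and B: "bounded B" and x: "\<And>s. 0 \<le> s \<Longrightarrow> s \<le> T \<Longrightarrow> x s \<in> B"
  shows "power_bounded T (1 / p) (\<lambda>s t. rde_increment l N V (incr N l X s t) (x s))"
  unfolding rde_increment_def
proof (rule power_bounded_sum[OF finite_rde_trees])
  fix \<tau> assume \<tau>: "\<tau> \<in> rde_trees l N"
  obtain M where M: "M > 0" "\<And>y. y \<in> B \<Longrightarrow> norm (vfield V \<tau> y) \<le> M"
  proof -
    have "bounded (vfield V \<tau> ` B)" by (rule bounded_vfield[OF _ B \<tau>]) (rule V)
    then show ?thesis using that by (auto simp: bounded_pos)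
  qed
  have "power_bounded T (real (tsize \<tau>) / p) (\<lambda>s t. incr N l X s t {#\<tau>#})"
    using power_bounded_incr[OF X] \<tau> by (simp add: N_def)
  moreover have "1 / p \<le> real (tsize \<tau>) / p"
    using tsize_pos[of \<tau>] \<open>p > 0\<close> by (simp add: divide_right_mono del: tsize_pos)
  ultimately have "power_bounded T (1 / p) (\<lambda>s t. incr N l X s t {#\<tau>#})"
    by (rule power_bounded_weaken)
  then show "power_bounded T (1 / p) (\<lambda>s t. (incr N l X s t {#\<tau>#} / real (tsigma \<tau>)) *\<^sub>R vfield V \<tau> (x s))"
  proof (rule power_bounded_mono)
    fix s t assume st: "0 \<le> s" "s \<le> t" "t \<le> T"
    have "\<bar>incr N l X s t {#\<tau>#}\<bar> / real (tsigma \<tau>) \<le> \<bar>incr N l X s t {#\<tau>#}\<bar> / 1"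
      using tsigma_pos[of \<tau>] by (intro divide_left_mono) auto
    then show "norm ((incr N l X s t {#\<tau>#} / real (tsigma \<tau>)) *\<^sub>R vfield V \<tau> (x s)) \<le>
        M * norm (incr N l X s t {#\<tau>#})"
      using mult_mono[OF _ M(2)[OF x], of "\<bar>incr N l X s t {#\<tau>#}\<bar> / real (tsigma \<tau>)" "\<bar>incr N l X s t {#\<tau>#}\<bar>" s] st
      by (simp add: mult.commute)
  qed (use M in simp)
qed

lemma davie_solution_iff:
  "davie_solution l p T X V z \<longleftrightarrow> (\<exists>a>1. power_bounded T a (\<lambda>s t. z t - z s -
     rde_increment l (nat \<lfloor>p\<rfloor>) V (incr (nat \<lfloor>p\<rfloor>) l X s t) (z s)))"
proof -
  have id: "bounded_linear (id :: 'a \<Rightarrow> 'a)" by (simp add: id_def bounded_linear_ident)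
  have "(\<Sum>\<phi>\<in>rde_forests l N. Y \<phi> *\<^sub>R diffop V \<phi> id x) = rde_increment l N V Y x" for N Y and x :: 'a
    using sum_diffop_bounded_linear[OF id] by (simp add: rde_increment_def)
  then show ?thesis
    unfolding davie_solution_def power_bounded_iff by simp
qed

lemma bailleul_solution_iff:
  "bailleul_solution l p T \<gamma> X V z \<longleftrightarrow> (\<exists>a>1. \<forall>f :: 'a::euclidean_space \<Rightarrow> real. C_gamma \<gamma> f \<longrightarrow>
     power_bounded T a (\<lambda>s t. f (z t) - f (z s) - (\<Sum>\<phi>\<in>rde_forests l (nat \<lfloor>p\<rfloor>).
       incr (nat \<lfloor>p\<rfloor>) l X s t \<phi> * diffop V \<phi> f (z s))))"
  unfolding bailleul_solution_def power_bounded_iff by simp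

section \<open>From Bailleul to Davie\<close>

text \<open>\<open>\<gamma> > 2\<close> makes the top order at least 2, where all derivatives of a
  linear function vanish; the Hoelder bound holds with constant 0.\<close>

lemma C_gamma_bounded_linear:
  fixes f :: "'a::euclidean_space \<Rightarrow> real"
  assumes f: "bounded_linear f" and "\<gamma> > 2"
  shows "C_gamma \<gamma> f"
proof -
  have k: "nat (\<lceil>\<gamma>\<rceil> - 1) \<ge> 2" using assms(2) by linarith
  have cont: "continuous_on UNIV f" by (rule linear_continuous_on[OF f])
  have diff: "f differentiable at x" for x using f by (rule bounded_linear_imp_differentiable)
  have 0: "nderiv f x hs = 0" if "length hs = nat (\<lceil>\<gamma>\<rceil> - 1)" for x hs
    using that k unfolding nderiv_bounded_linear[OF f] by (auto split: list.split)
  show ?thesis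
    unfolding C_gamma_def Let_def
  proof (intro conjI allI impI)
    show "(\<lambda>y. nderiv f y hs) differentiable at x" for hs x
      unfolding nderiv_bounded_linear[OF f] using diff by (cases hs; cases "tl hs") auto
    show "continuous_on UNIV (\<lambda>y. nderiv f y hs)" for hs
      unfolding nderiv_bounded_linear[OF f] using cont by (cases hs; cases "tl hs") auto
  qed (use 0 in \<open>auto intro!: exI[of _ 0]\<close>)
qed

text \<open>The exponent \<open>a\<close> does not depend on the test function, so the bounds for
  the finitely many coordinates add up to one for the l1 norm, hence for the norm.\<close>

lemma bailleul_imp_davie:
  fixes V :: "nat \<Rightarrow> 'a::euclidean_space \<Rightarrow> 'a"
  assumes "\<gamma> > 2" and "bailleul_solution l p T \<gamma> X V z"
  shows "davie_solution l p T X V z"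
proof -
  define D where "D s t = z t - z s - rde_increment l (nat \<lfloor>p\<rfloor>) V (incr (nat \<lfloor>p\<rfloor>) l X s t) (z s)" for s t
  from assms(2) obtain a where "a > 1" and a: "\<And>f :: 'a \<Rightarrow> real. C_gamma \<gamma> f \<Longrightarrow>
      power_bounded T a (\<lambda>s t. f (z t) - f (z s) - (\<Sum>\<phi>\<in>rde_forests l (nat \<lfloor>p\<rfloor>).
       incr (nat \<lfloor>p\<rfloor>) l X s t \<phi> * diffop V \<phi> f (z s)))"
    unfolding bailleul_solution_iff by blast
  have D: "power_bounded T a (\<lambda>s t. D s t \<bullet> b)" for b
  proof -
    have b: "bounded_linear (\<lambda>x. x \<bullet> b)" by (rule bounded_linear_inner_left)
    show ?thesis
      using a[OF C_gamma_bounded_linear[OF b assms(1)]] sum_diffop_bounded_linear[OF b]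
      by (simp add: D_def rde_increment_def inner_diff_left)
  qed
  have "power_bounded T a (\<lambda>s t. \<Sum>b\<in>Basis. \<bar>D s t \<bullet> b\<bar>)"
    by (intro power_bounded_sum finite_Basis power_bounded_mono[OF D, where M = 1]) auto
  then have "power_bounded T a D"
    by (rule power_bounded_mono[where M = 1]) (auto intro: norm_le_l1 order_trans)
  with \<open>a > 1\<close> show ?thesis unfolding davie_solution_iff D_def by blast
qed

section \<open>From Davie to Bailleul\<close>

text \<open>Only increments starting at time 0 are used: their base point \<open>z 0\<close> is
  fixed, so the vector fields are bounded there without any prior bound on \<open>z\<close>.\<close>

lemma davie_imp_bounded:
  fixes V :: "nat \<Rightarrow> 'a::euclidean_space \<Rightarrow> 'a" and p :: real
  defines "N \<equiv> nat \<lfloor>p\<rfloor>"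
  assumes X: "branched_rough_path l p T X" and "p > 0"
    and V: "\<And>a. a \<in> {1..l} \<Longrightarrow> C_times N (V a)"
    and z: "power_bounded T a (\<lambda>s t. z t - z s - rde_increment l N V (incr N l X s t) (z s))" and "a > 0"
  shows "bounded (z ` {0..T})"
proof -
  let ?H = "\<lambda>s t. rde_increment l N V (incr N l X s t)"
  obtain C where C: "C \<ge> 0" "\<And>s t. 0 \<le> s \<Longrightarrow> s \<le> t \<Longrightarrow> t \<le> T \<Longrightarrow>
      norm (z t - z s - ?H s t (z s)) \<le> C * (t - s) powr a"
    using z by (rule power_boundedE) blast
  have "power_bounded T (1 / p) (\<lambda>s t. ?H s t (z 0))"
    using power_bounded_rde_increment[OF X \<open>p > 0\<close>, where V = V and B = "{z 0}" and x = "\<lambda>_. z 0"] V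
    by (simp add: N_def)
  then obtain K where K: "K \<ge> 0" "\<And>s t. 0 \<le> s \<Longrightarrow> s \<le> t \<Longrightarrow> t \<le> T \<Longrightarrow>
      norm (?H s t (z 0)) \<le> K * (t - s) powr (1 / p)"
    by (rule power_boundedE) blast
  have "norm (z t) \<le> norm (z 0) + K * T powr (1 / p) + C * T powr a" if t: "t \<in> {0..T}" for t
  proof -
    have "norm (z t) = norm (z 0 + ?H 0 t (z 0) + (z t - z 0 - ?H 0 t (z 0)))" by simp
    also have "\<dots> \<le> norm (z 0) + norm (?H 0 t (z 0)) + norm (z t - z 0 - ?H 0 t (z 0))"
      by (intro norm_triangle_le add_right_mono norm_triangle_ineq) simp
    also have "norm (?H 0 t (z 0)) \<le> K * t powr (1 / p)"
      using K(2)[of 0 t] t by simp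
    also have "\<dots> \<le> K * T powr (1 / p)"
      using t K(1) \<open>p > 0\<close> by (intro mult_left_mono powr_mono2) auto
    also have "norm (z t - z 0 - ?H 0 t (z 0)) \<le> C * t powr a"
      using C(2)[of 0 t] t by simp
    also have "\<dots> \<le> C * T powr a"
      using t C(1) \<open>a > 0\<close> by (intro mult_left_mono powr_mono2) auto
    finally show ?thesis by simp
  qed
  then show ?thesis unfolding bounded_iff by blast
qed

text \<open>Grouping by number of trees turns the orders 1 to \<open>N\<close> into one sum over
  forests, which splits by vertex number: up to \<open>N\<close> the character property gives
  \<open>Y \<phi>\<close>, beyond \<open>N\<close> the product of tree coefficients remains.\<close>

lemma sum_taylor_terms_eq_sum_diffop:
  fixes f :: "'a::real_normed_vector \<Rightarrow> real"
  assumes f: "C_times N f" and Y: "trunc_character N Y"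
  shows "(\<Sum>m\<le>N. nderiv f x (replicate m (rde_increment l N V Y x)) / fact m) =
    f x + (\<Sum>\<phi>\<in>rde_forests l N. Y \<phi> * diffop V \<phi> f x) +
    (\<Sum>\<phi> | set_mset \<phi> \<subseteq> rde_trees l N \<and> size \<phi> \<in> {1..N} \<and> fsize \<phi> > N.
       (\<Prod>t\<in>#\<phi>. Y {#t#}) * diffop V \<phi> f x)"
proof -
  define A where "A = {\<phi>. set_mset \<phi> \<subseteq> rde_trees l N \<and> size \<phi> \<in> {1..N}}"
  let ?A' = "{\<phi>. set_mset \<phi> \<subseteq> rde_trees l N \<and> size \<phi> \<in> {1..N} \<and> fsize \<phi> > N}"
  let ?g = "\<lambda>\<phi>. (\<Prod>t\<in>#\<phi>. Y {#t#}) * diffop V \<phi> f x"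
  have finA: "finite A"
    by (rule finite_subset[OF _ finite_multisets_size_le[OF finite_rde_trees[of l N], of N]])
      (auto simp: A_def)
  have "{..N} = insert 0 {1..N}" by auto
  then have "(\<Sum>m\<le>N. nderiv f x (replicate m (rde_increment l N V Y x)) / fact m) =
      f x + (\<Sum>m=1..N. nderiv f x (replicate m (rde_increment l N V Y x)) / fact m)"
    by simp
  also have "(\<Sum>m=1..N. nderiv f x (replicate m (rde_increment l N V Y x)) / fact m) =
      (\<Sum>m=1..N. \<Sum>\<phi> | \<phi> \<in> A \<and> size \<phi> = m. ?g \<phi>)"
  proof (intro sum.cong refl)
    fix m assume m: "m \<in> {1..N}"
    then have "{\<phi>. \<phi> \<in> A \<and> size \<phi> = m} = {\<phi>. set_mset \<phi> \<subseteq> rde_trees l N \<and> size \<phi> = m}"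
      by (auto simp: A_def)
    with m show "nderiv f x (replicate m (rde_increment l N V Y x)) / fact m = (\<Sum>\<phi> | \<phi> \<in> A \<and> size \<phi> = m. ?g \<phi>)"
      unfolding rde_increment_def by (subst taylor_term_eq_sum_diffop[OF f]) auto
  qed
  also have "\<dots> = (\<Sum>\<phi>\<in>A. ?g \<phi>)"
    by (rule sum.group[OF finA]) (auto simp: A_def)
  also have "A = rde_forests l N \<union> ?A'"
    by (auto simp: A_def rde_forests_eq)
  also have "(\<Sum>\<phi>\<in>\<dots>. ?g \<phi>) = (\<Sum>\<phi>\<in>rde_forests l N. ?g \<phi>) + (\<Sum>\<phi>\<in>?A'. ?g \<phi>)"
    by (rule sum.union_disjoint[OF finite_rde_forests])
      (auto simp: rde_forests_eq intro: finite_subset[OF _ finA] simp: A_def)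
  also have "(\<Sum>\<phi>\<in>rde_forests l N. ?g \<phi>) = (\<Sum>\<phi>\<in>rde_forests l N. Y \<phi> * diffop V \<phi> f x)"
    by (intro sum.cong refl) (auto simp: rde_forests_eq trunc_character_prod_mset[OF Y])
  finally show ?thesis by simp
qed

text \<open>The error has three sources: replacing \<open>z t\<close> by \<open>z s + H s t\<close>
  (\<open>E1\<close>), the Taylor remainder (\<open>E2\<close>) and the forests with more than
  \<open>N\<close> vertices (\<open>E3\<close>).\<close>

lemma davie_imp_bailleul:
  fixes V :: "nat \<Rightarrow> 'a::euclidean_space \<Rightarrow> 'a"
  assumes p: "p \<ge> 1" and T: "T > 0" and X: "branched_rough_path l p T X"
    and \<gamma>: "\<gamma> > p" and V\<gamma>: "\<And>a. a \<in> {1..l} \<Longrightarrow> C_gamma \<gamma> (V a)"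
    and davie: "davie_solution l p T X V z"
  shows "bailleul_solution l p T \<gamma> X V z"
proof -
  define N where "N = nat \<lfloor>p\<rfloor>"
  have N: "1 \<le> N" "real N \<le> p" "p < real N + 1" "real N < \<gamma>" "N \<le> nat (\<lceil>\<gamma>\<rceil> - 1)"
    using p \<gamma> unfolding N_def by linarith+
  have V: "C_times N (V a)" if "a \<in> {1..l}" for a
    using C_gamma_imp_C_times[OF V\<gamma>[OF that]] N(5) by (rule C_times_le)
  define H where "H s t = rde_increment l N V (incr N l X s t) (z s)" for s t
  obtain a where "a > 1" and za: "power_bounded T a (\<lambda>s t. z t - z s - H s t)"
    using davie unfolding davie_solution_iff H_def N_def by blast
  have "bounded (z ` {0..T})"
    by (rule davie_imp_bounded[OF X, where a = a]) (use p T V za \<open>a > 1\<close> in \<open>auto simp: N_def H_def\<close>)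
  then obtain R0 where "\<forall>s\<in>{0..T}. norm (z s) \<le> R0"
    by (auto simp: bounded_iff)
  then have R0: "norm (z s) \<le> R0" if "0 \<le> s" "s \<le> T" for s
    using that by simp
  have Hb: "power_bounded T (1 / p) H"
    using power_bounded_rde_increment[OF X, where V = V and B = "cball 0 R0" and x = z] V R0 p
    by (simp add: N_def H_def[abs_def])
  then obtain K where K: "K \<ge> 0" "\<And>s t. 0 \<le> s \<Longrightarrow> s \<le> t \<Longrightarrow> t \<le> T \<Longrightarrow>
      norm (H s t) \<le> K * (t - s) powr (1 / p)"
    by (rule power_boundedE) blast
  \<comment> \<open>The ball of radius \<open>R\<close> contains every \<open>z s\<close> and every
    \<open>z s + H s t\<close>, so one Lipschitz constant and one Taylor constant serve all
    times.\<close>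
  define R where "R = R0 + K * T powr (1 / p)"
  have zR: "norm (z s) \<le> R" if "0 \<le> s" "s \<le> T" for s
    using R0[OF that] K(1) by (simp add: R_def add_increasing2)
  have HR: "norm (z s + H s t) \<le> R" if st: "0 \<le> s" "s \<le> t" "t \<le> T" for s t
  proof -
    have "norm (H s t) \<le> K * (t - s) powr (1 / p)" by (rule K(2)[OF st])
    also have "\<dots> \<le> K * T powr (1 / p)"
      using st K(1) p by (intro mult_left_mono powr_mono2) auto
    finally show ?thesis
      using R0[of s] st norm_triangle_ineq[of "z s" "H s t"] by (simp add: R_def)
  qed
  \<comment> \<open>\<open>\<beta>\<close> is the exponent of the Taylor remainder, and
    \<open>H\<close> of order \<open>1 / p\<close> turns it into \<open>\<beta> / p > 1\<close>. The
    exponent \<open>e\<close> is fixed before \<open>f\<close>, as the quantifiers of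
    \<open>bailleul_solution\<close> demand.\<close>
  define \<beta> where "\<beta> = min \<gamma> (real N + 1)"
  define e where "e = min a (\<beta> / p)"
  have \<beta>: "\<beta> > p" using \<gamma> N by (simp add: \<beta>_def)
  have e: "e > 1" "e \<le> a" "e \<le> \<beta> / p" using \<beta> p \<open>a > 1\<close> by (simp_all add: e_def)
  have "power_bounded T e (\<lambda>s t. f (z t) - f (z s) -
      (\<Sum>\<phi>\<in>rde_forests l N. incr N l X s t \<phi> * diffop V \<phi> f (z s)))"
    if f: "C_gamma \<gamma> f" for f :: "'a \<Rightarrow> real"
  proof -
    have fN: "C_times N f" using C_gamma_imp_C_times[OF f] N(5) by (rule C_times_le)
    let ?T = "\<lambda>s t. \<Sum>m\<le>N. nderiv f (z s) (replicate m (H s t)) / fact m"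
    let ?A = "{\<phi>. set_mset \<phi> \<subseteq> rde_trees l N \<and> size \<phi> \<in> {1..N} \<and> fsize \<phi> > N}"
    let ?g = "\<lambda>\<phi> s t. (\<Prod>\<tau>\<in>#\<phi>. incr N l X s t {#\<tau>#}) * diffop V \<phi> f (z s)"
    obtain L where L: "L \<ge> 0" "\<forall>x\<in>cball 0 R. \<forall>y\<in>cball 0 R. \<bar>f y - f x\<bar> \<le> L * norm (y - x)"
      using C_times_lipschitz[OF fN N(1)] by blast
    have "power_bounded T a (\<lambda>s t. f (z t) - f (z s + H s t))"
    proof (rule power_bounded_mono[OF za, of _ L])
      fix s t assume st: "0 \<le> s" "s \<le> t" "t \<le> T"
      show "norm (f (z t) - f (z s + H s t)) \<le> L * norm (z t - z s - H s t)"
        using L(2)[rule_format, of "z s + H s t" "z t"] HR[OF st] zR[of t] st by (simp add: algebra_simps)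
    qed (fact L)
    then have E1: "power_bounded T e (\<lambda>s t. f (z t) - f (z s + H s t))"
      using e(2) by (rule power_bounded_weaken)
    obtain C where C: "C \<ge> 0" "\<forall>x h. norm x \<le> R \<and> norm (x + h) \<le> R \<longrightarrow>
        \<bar>f (x + h) - (\<Sum>m\<le>N. nderiv f x (replicate m h) / fact m)\<bar> \<le> C * norm h powr \<beta>"
      using C_gamma_taylor[OF f N(1,4), of R] unfolding \<beta>_def by blast
    have "power_bounded T (1 / p * \<beta>) (\<lambda>s t. f (z s + H s t) - ?T s t)"
    proof (rule power_bounded_mono[OF power_bounded_norm_powr[OF Hb], of _ _ C])
      fix s t assume st: "0 \<le> s" "s \<le> t" "t \<le> T"
      show "norm (f (z s + H s t) - ?T s t) \<le> C * norm (norm (H s t) powr \<beta>)"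
        using C(2)[rule_format, of "z s" "H s t"] HR[OF st] zR[of s] st by simp
    qed (use C \<beta> p in auto)
    then have E2: "power_bounded T e (\<lambda>s t. f (z s + H s t) - ?T s t)"
      by (rule power_bounded_weaken) (use e in simp)
    have E3: "power_bounded T e (\<lambda>s t. \<Sum>\<phi>\<in>?A. ?g \<phi> s t)"
    proof (rule power_bounded_sum)
      show "finite ?A"
        by (rule finite_subset[OF _ finite_multisets_size_le[OF finite_rde_trees[of l N], of N]]) auto
      fix \<phi> assume \<phi>: "\<phi> \<in> ?A"
      have "power_bounded T (real (fsize \<phi>) / p) (\<lambda>s t. \<Prod>\<tau>\<in>#\<phi>. incr N l X s t {#\<tau>#})"
        using \<phi> by (intro power_bounded_prod_mset) (auto simp: N_def intro!: power_bounded_incr[OF X])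
      \<comment> \<open>More than \<open>N\<close> vertices means at least \<open>N + 1\<close>, and
        \<open>\<beta>\<close> is at most \<open>N + 1\<close>.\<close>
      moreover have "\<beta> / p \<le> real (fsize \<phi>) / p"
        using \<phi> p by (intro divide_right_mono) (auto simp: \<beta>_def)
      ultimately have *: "power_bounded T e (\<lambda>s t. \<Prod>\<tau>\<in>#\<phi>. incr N l X s t {#\<tau>#})"
        using e(3) by (blast intro: power_bounded_weaken order_trans)
      have "bounded (diffop V \<phi> f ` cball 0 R)"
        using \<phi> by (intro bounded_diffop[OF V fN]) auto
      then obtain M where M: "M > 0" "\<And>x. norm x \<le> R \<Longrightarrow> \<bar>diffop V \<phi> f x\<bar> \<le> M"
        by (auto simp: bounded_pos)
      show "power_bounded T e (?g \<phi>)"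
      proof (rule power_bounded_mono[OF *, of _ M])
        fix s t assume st: "0 \<le> s" "s \<le> t" "t \<le> T"
        show "norm (?g \<phi> s t) \<le> M * norm (\<Prod>\<tau>\<in>#\<phi>. incr N l X s t {#\<tau>#})"
          unfolding real_norm_def abs_mult
          by (subst mult.commute, rule mult_right_mono) (use M(2)[OF zR[of s]] st in auto)
      qed (use M in simp)
    qed
    have "power_bounded T e (\<lambda>s t. (f (z t) - f (z s + H s t)) +
        ((f (z s + H s t) - ?T s t) + (\<Sum>\<phi>\<in>?A. ?g \<phi> s t)))"
      by (intro power_bounded_add E1 E2 E3)
    then show ?thesis
    proof (rule power_bounded_cong)
      fix s t assume st: "0 \<le> s" "s \<le> t" "t \<le> T"
      have "trunc_character N (incr N l X s t)"
        using X st by (intro trunc_character_incr) (auto simp: branched_rough_path_def N_def)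
      from sum_taylor_terms_eq_sum_diffop[OF fN this, of "z s" l V]
      show "f (z t) - f (z s) - (\<Sum>\<phi>\<in>rde_forests l N. incr N l X s t \<phi> * diffop V \<phi> f (z s)) =
        (f (z t) - f (z s + H s t)) + ((f (z s + H s t) - ?T s t) + (\<Sum>\<phi>\<in>?A. ?g \<phi> s t))"
        unfolding H_def[of s t] by simp
    qed
  qed
  with e(1) show ?thesis unfolding bailleul_solution_iff N_def by blast
qed

theorem theorem2:
  fixes l :: nat and p T \<gamma> :: real
    and X :: "real \<Rightarrow> forest \<Rightarrow> real"
    and V :: "nat \<Rightarrow> real ^ 'd \<Rightarrow> real ^ 'd"
    and z :: "real \<Rightarrow> real ^ 'd"
  assumes "l \<ge> 1" and "p > 2" and "T > 0"
    and "branched_rough_path l p T X"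
    and "\<gamma> > p"
    and "\<forall>a\<in>{1..l}. C_gamma \<gamma> (V a)"
  shows "davie_solution l p T X V z \<longleftrightarrow> bailleul_solution l p T \<gamma> X V z"
proof
  assume "davie_solution l p T X V z"
  with assms show "bailleul_solution l p T \<gamma> X V z"
    by (intro davie_imp_bailleul) auto
next
  assume "bailleul_solution l p T \<gamma> X V z"
  with assms show "davie_solution l p T X V z"
    by (intro bailleul_imp_davie[of \<gamma>]) auto
qed

end
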